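(* Let $\kappa>0$ and $l\in\mathbb C$, and let $$S_{\kappa,l}=\{(\zeta_1,\zeta_2)\in\mathbb C^2:\Im\zeta_2=\kappa|\zeta_1|^2-\Re(l\zeta_1^2)\},$$ which is the boundary of the domain $$\mathcal D_{\kappa,l}=\{(z_1,z_2)\in\mathbb C^2:\Im z_2>\kappa|z_1|^2-\Re(l z_1^2)\}.$$ Then the Szegő kernel $S$ of $S_{\kappa,l}$ is given, for $(z',z),(w',w)\in\mathcal D_{\kappa,l}$, by $$S((z',z),(w',w))=\frac{\kappa}{\pi^2}\left(i(\overline w-z)-2\kappa z'\overline{w'}+l\,(z'^2+\overline{w'}^2)\right)^{-2}.$$
   Context: Write $p(z')=\kappa|z'|^2-\Re(lz'^2)$. The Hardy space $H^2(\mathcal D_{\kappa,l})$ consists of the holomorphic functions $F$ on $\mathcal D_{\kappa,l}$ with $$\|F\|^2=\sup_{\varepsilon>0}\int_{\mathbb C}\int_{\mathbb R}|F(z',t+i(p(z')+\varepsilon))|^2\,dt\,d\lambda(z')<\infty,$$ where $d\lambda$ is Lebesgue measure on $\mathbb C$; i.e. the boundary $S_{\kappa,l}$ is parametrized by $(z',t)\mapsto(z',t+ip(z'))$, $(z',t)\in\mathbb C\times\mathbb R$, and carries the measure $d\lambda(z')\,dt$. The Szegő kernel $S((z',z),(w',w))$ is the reproducing kernel of this Hilbert space: $S(\cdot,(w',w))\in H^2(\mathcal D_{\kappa,l})$ and $F(w',w)=\langle F,S(\cdot,(w',w))\rangle$ for all $F\in H^2(\mathcal D_{\kappa,l})$ and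 $(w',w)\in\mathcal D_{\kappa,l}$.
   Formalization: The term l(z'^2 + conj(w')^2) is corrected to l z'^2 + conj(l) conj(w')^2; for non-real l the printed formula is not real on the diagonal, e.g. at z=w=(1,iy) with y large, so it cannot be a reproducing kernel. For real l the two agree. *)

theory Defs
  imports "HOL-Analysis.Analysis"
begin

definition quad_phase :: "real \<Rightarrow> complex \<Rightarrow> complex \<Rightarrow> real" where
  "quad_phase \<kappa> l z' = \<kappa> * (cmod z')\<^sup>2 - Re (l * z'\<^sup>2)"

definition quad_domain :: "real \<Rightarrow> complex \<Rightarrow> (complex \<times> complex) set" where
  "quad_domain \<kappa> l = {(z', z). Im z > quad_phase \<kappa> l z'}"

definition quad_surface :: "real \<Rightarrow> complex \<Rightarrow> (complex \<times> complex) set" where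
  "quad_surface \<kappa> l = {(z', z). Im z = quad_phase \<kappa> l z'}"

text \<open>Holomorphy in two variables on an open set: at every point the real derivative
  exists and is complex linear.\<close>

definition holomorphic_on2 :: "(complex \<times> complex \<Rightarrow> complex) \<Rightarrow> (complex \<times> complex) set \<Rightarrow> bool" where
  "holomorphic_on2 F D \<longleftrightarrow>
     (\<forall>p\<in>D. \<exists>a b. (F has_derivative (\<lambda>(h1, h2). a * h1 + b * h2)) (at p))"

definition hardy_norm_sq :: "real \<Rightarrow> complex \<Rightarrow> (complex \<times> complex \<Rightarrow> complex) \<Rightarrow> ennreal" where
  "hardy_norm_sq \<kappa> l F =
     (SUP \<epsilon>\<in>{0<..}. \<integral>\<^sup>+ z'. (\<integral>\<^sup>+ t.
        ennreal ((cmod (F (z', complex_of_real t + \<i> * complex_of_real (quad_phase \<kappa> l z' + \<epsilon>))))\<^sup>2)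
          \<partial>lborel) \<partial>lborel)"

text \<open>Elements are total functions; only their values on the domain matter, so that an
  element of the Hardy space is represented by all its extensions.\<close>

definition hardy_space :: "real \<Rightarrow> complex \<Rightarrow> (complex \<times> complex \<Rightarrow> complex) set" where
  "hardy_space \<kappa> l = {F. holomorphic_on2 F (quad_domain \<kappa> l) \<and> hardy_norm_sq \<kappa> l F < \<infinity>}"

text \<open>The inner product inducing the Hardy norm, linear in the first argument, recovered
  from the norm by polarization.\<close>

definition hardy_inner ::
  "real \<Rightarrow> complex \<Rightarrow> (complex \<times> complex \<Rightarrow> complex) \<Rightarrow> (complex \<times> complex \<Rightarrow> complex) \<Rightarrow> complex" where
  "hardy_inner \<kappa> l F G =
     (\<Sum>k<4. \<i> ^ k * complex_of_real (enn2real (hardy_norm_sq \<kappa> l (\<lambda>p. F p + \<i> ^ k * G p)))) / 4"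

text \<open>Being total, such an S is determined only on the product of the domain with itself.\<close>

definition is_szego_kernel ::
  "real \<Rightarrow> complex \<Rightarrow> (complex \<times> complex \<Rightarrow> complex \<times> complex \<Rightarrow> complex) \<Rightarrow> bool" where
  "is_szego_kernel \<kappa> l S \<longleftrightarrow>
     (\<forall>w\<in>quad_domain \<kappa> l. (\<lambda>z. S z w) \<in> hardy_space \<kappa> l \<and>
        (\<forall>F\<in>hardy_space \<kappa> l. F w = hardy_inner \<kappa> l F (\<lambda>z. S z w)))"

text \<open>Such a kernel is Hermitian symmetric. The coefficient of the square of the conjugated
  variable in its closed form is therefore \<^term>\<open>cnj l\<close>; if l itself stood there, the formula
  would fail for every non-real l. For real l there is no difference.\<close>

end

theory Submission
  imports Defs "HOL-Complex_Analysis.Complex_Analysis"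
begin

unbundle no fps_syntax

text \<open>
  A quadratic shear composed with a Heisenberg translation reduces the reproducing property to \<open>l = 0\<close>
  and a pole \<open>(0, w)\<close>, where the kernel is \<open>- \<kappa> / (\<pi>\<^sup>2 (z - cnj w)\<^sup>2)\<close>. On the level
  \<open>Im z = \<kappa> |\<zeta>|\<^sup>2 + \<epsilon>\<close> this function depends on \<open>\<zeta>\<close> through \<open>|\<zeta>|\<close> only, so
  averaging over rotations of \<open>\<zeta>\<close> replaces \<open>F(\<zeta>, z)\<close> by \<open>f(z) = F(0, z)\<close>. Cauchy's formula on
  horizontal lines then turns the integral over \<open>t\<close> into a multiple of \<open>f'(w + 2i(\<kappa> |\<zeta>|\<^sup>2 + \<epsilon>))\<close>,
  and the integral over \<open>\<zeta>\<close>, taken in the variable \<open>|\<zeta>|\<^sup>2\<close>, telescopes to \<open>f(w + 2i\<epsilon>)\<close>.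
  The supremum defining the norm is a limit as \<open>\<epsilon>\<close> tends to \<open>0\<close>, because the integral over a level decreases
  with its height: a mean value estimate over bidiscs bounds every slice \<open>F(\<zeta>, .)\<close>, and Poisson's formula
  applies. Hence the polarized norms converge to the pairing just computed.

  Uniqueness follows from the Hermitian symmetry of the polarized norm: two kernels \<open>S\<close> and \<open>K\<close>
  satisfy \<open>S(p, q) = cnj (K(q, p))\<close>.
\<close>

section \<open>Lebesgue measure on the complex plane\<close>

text \<open>The inner product is known only through suprema over levels, so neither its linearity
  nor boundary values of the functions are at hand. On a single level, however, the norm is an L2
  norm and polarization is a pointwise identity under the integral. Monotonicity in the height makes
  all four suprema limits along one common sequence of levels; this is the only bridge from levels
  to the inner product. Rotations are available because turning \<zeta> keeps |\<zeta>| and hence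
  the point z of the level, and F(., z) is holomorphic around the closed disc of radius |\<zeta>|.
  The doubled height comes from a reflection: f is read at height y, while the conjugated kernel has
  its pole at w + iy. The constant \<open>\<kappa> / pi\<^sup>2\<close> balances the factor pi of
  area measured in |\<zeta>|^2, the 2 pi i of Cauchy's formula and the chain-rule factor 2i\<kappa>
  of the last integration. The upper end of the telescoping vanishes because F(0, .) decays at great
  height.\<close>

text \<open>Serves the rotation lemma below: orthogonal invariance of the measure is applied in
  \<open>real^2\<close>, and this is the passage to it. Agreement on boxes suffices.\<close>

lemma lborel_complex_eq_distr_vec:
  "distr lborel borel (\<lambda>v::real^2. Complex (v$1) (v$2)) = lborel"
proof (rule lborel_eqI[symmetric])
  have [measurable]: "(\<lambda>v::real^2. Complex (v$1) (v$2)) \<in> borel_measurable borel"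
    by (intro borel_measurable_continuous_onI) (auto simp: Complex_eq intro!: continuous_intros)
  fix l u :: complex
  assume le: "\<And>b. b \<in> Basis \<Longrightarrow> l \<bullet> b \<le> u \<bullet> b"
  have "(\<lambda>v::real^2. Complex (v$1) (v$2)) -` box l u
      = box (vector [Re l, Im l]) (vector [Re u, Im u])"
    by (auto simp: mem_box_cart in_box_complex_iff forall_2)
  moreover have "emeasure lborel (box (vector [Re l, Im l]) (vector [Re u, Im u]) :: (real^2) set)
     = (\<Prod>b\<in>Basis. (u - l) \<bullet> b)"
  proof -
    have B: "(Basis :: (real^2) set) = {axis 1 1, axis 2 1}"
      by (auto simp: Basis_vec_def UNIV_2)
    have ne: "axis 1 1 \<noteq> (axis 2 1 :: real^2)" by (simp add: axis_eq_axis)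
    show ?thesis
      using le[of 1] le[of \<i>] ne
      by (subst emeasure_lborel_box) (auto simp: B Basis_complex_def inner_axis inner_diff_left)
  qed
  ultimately show "emeasure (distr lborel borel (\<lambda>v::real^2. Complex (v$1) (v$2))) (box l u)
     = (\<Prod>b\<in>Basis. (u - l) \<bullet> b)"
    by (simp add: emeasure_distr)
qed simp

lemma lborel_complex_eq_distr_prod:
  "distr lborel borel (\<lambda>p::real\<times>real. Complex (fst p) (snd p)) = lborel"
proof (rule lborel_eqI[symmetric])
  have [measurable]: "(\<lambda>p::real\<times>real. Complex (fst p) (snd p)) \<in> borel_measurable borel"
    by (intro borel_measurable_continuous_onI) (auto simp: Complex_eq intro!: continuous_intros)
  fix l u :: complex
  assume le: "\<And>b. b \<in> Basis \<Longrightarrow> l \<bullet> b \<le> u \<bullet> b"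
  have le': "Re l \<le> Re u" "Im l \<le> Im u"
    using le[of 1] le[of \<i>] by (auto simp: Basis_complex_def)
  have "(\<lambda>p::real\<times>real. Complex (fst p) (snd p)) -` box l u = box (Re l) (Re u) \<times> box (Im l) (Im u)"
    by (auto simp: in_box_complex_iff)
  moreover have "emeasure lborel (box (Re l) (Re u) \<times> box (Im l) (Im u))
     = (\<Prod>b\<in>Basis. (u - l) \<bullet> b)"
    using le' by (simp add: lborel_prod[symmetric] lborel.emeasure_pair_measure_Times Basis_complex_def
       ennreal_mult)
  ultimately show "emeasure (distr lborel borel (\<lambda>p::real\<times>real. Complex (fst p) (snd p))) (box l u)
     = (\<Prod>b\<in>Basis. (u - l) \<bullet> b)"
    by (simp add: emeasure_distr)
qed simp

text \<open>In real coordinates, multiplication by a unit is an orthogonal map. A preimage under it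
  is an image under its inverse, which is why \<open>T\<close> multiplies by
  \<open>cnj c\<close>.\<close>

lemma lborel_complex_rotation:
  assumes "cmod c = 1"
  shows "distr lborel borel (\<lambda>z. c * z) = (lborel :: complex measure)"
proof (rule lborel_eqI[symmetric])
  define \<psi> where "\<psi> = (\<lambda>v::real^2. Complex (v$1) (v$2))"
  define \<phi> where "\<phi> = (\<lambda>z. vector [Re z, Im z] :: real^2)"
  have [measurable]: "\<psi> \<in> borel_measurable borel"
    unfolding \<psi>_def by (intro borel_measurable_continuous_onI) (auto simp: Complex_eq intro!: continuous_intros)
  have \<psi>\<phi>: "\<psi> (\<phi> z) = z" "\<phi> (\<psi> v) = v" for z v
    by (auto simp: \<psi>_def \<phi>_def vec_eq_iff forall_2)
  define T where "T v = \<phi> (cnj c * \<psi> v)" for v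
  have T: "orthogonal_transformation T"
  proof -
    have *: "T v = vector [Re c * v$1 + Im c * v$2, Re c * v$2 - Im c * v$1]" for v
      by (simp add: T_def \<psi>_def \<phi>_def algebra_simps)
    have "linear T"
      by (rule linearI) (auto simp: * vec_eq_iff forall_2 algebra_simps)
    moreover have "T v \<bullet> T w = v \<bullet> w" for v w
    proof -
      have "T v \<bullet> T w = ((Re c)\<^sup>2 + (Im c)\<^sup>2) * (v \<bullet> w)"
        by (simp add: * inner_vec_def sum_2 algebra_simps power2_eq_square)
      then show ?thesis using assms by (simp add: cmod_def)
    qed
    ultimately show ?thesis by (simp add: orthogonal_transformation_def)
  qed
  have c: "c * cnj c = 1" using assms by (simp add: complex_norm_square[symmetric])
  fix l u :: complex
  assume le: "\<And>b. b \<in> Basis \<Longrightarrow> l \<bullet> b \<le> u \<bullet> b"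
  have bd: "(\<psi> -` box l u) = box (\<phi> l) (\<phi> u)"
    by (auto simp: \<psi>_def \<phi>_def mem_box_cart in_box_complex_iff forall_2)
  have im: "\<psi> -` ((\<lambda>z. c * z) -` box l u) = T ` (\<psi> -` box l u)"
  proof -
    have "v \<in> T ` (\<psi> -` box l u)" if "c * \<psi> v \<in> box l u" for v
      using that c by (intro image_eqI[of _ _ "\<phi> (c * \<psi> v)"]) (auto simp: T_def \<psi>\<phi> mult.assoc[symmetric] mult.commute)
    moreover have "c * \<psi> (T v) = \<psi> v" for v
      using c by (simp add: T_def \<psi>\<phi> mult.assoc[symmetric])
    ultimately show ?thesis by auto
  qed
  have sB: "\<psi> -` ((\<lambda>z. c * z) -` box l u) \<in> sets borel"
  proof -
    have "(\<lambda>z. c * z) -` box l u \<in> sets borel"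
      by (rule measurable_sets_borel[where M=borel]) auto
    then show ?thesis by (rule measurable_sets_borel[rotated]) measurable
  qed
  have lm: "\<psi> -` box l u \<in> lmeasurable" by (simp add: bd)
  have "emeasure (distr lborel borel (\<lambda>z. c * z)) (box l u) = emeasure lborel ((\<lambda>z. c * z) -` box l u)"
    by (simp add: emeasure_distr)
  also have "\<dots> = emeasure (distr lborel borel \<psi>) ((\<lambda>z. c * z) -` box l u)"
    unfolding \<psi>_def lborel_complex_eq_distr_vec ..
  also have "\<dots> = emeasure lborel (\<psi> -` ((\<lambda>z. c * z) -` box l u))"
    by (subst emeasure_distr) (auto intro!: measurable_sets_borel[where M=borel])
  \<comment> \<open>The result on orthogonal images concerns Lebesgue measurable sets, hence the
    detour through the completed measure.\<close>
  also have "\<dots> = emeasure lebesgue (\<psi> -` ((\<lambda>z. c * z) -` box l u))"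
    using sB by (simp add: emeasure_completion)
  also have "\<dots> = emeasure lebesgue (\<psi> -` box l u)"
    unfolding im
    using measurable_orthogonal_image[OF T lm] measure_orthogonal_image[OF T lm] lm
    by (simp add: emeasure_eq_measure2)
  also have "\<dots> = emeasure lborel (\<psi> -` box l u)"
    by (simp add: bd emeasure_completion)
  also have "\<dots> = emeasure (distr lborel borel \<psi>) (box l u)"
    by (subst emeasure_distr) auto
  also have "\<dots> = emeasure lborel (box l u)"
    unfolding \<psi>_def lborel_complex_eq_distr_vec ..
  also have "\<dots> = (\<Prod>b\<in>Basis. (u - l) \<bullet> b)" using le by (simp add: emeasure_lborel_box)
  finally show "emeasure (distr lborel borel (\<lambda>z. c * z)) (box l u) = (\<Prod>b\<in>Basis. (u - l) \<bullet> b)" .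
qed simp

text \<open>The disc where |z|^2 is at most x has area pi x, which is linear in x. In the variable
  |z|^2 the area therefore has constant density, and polar coordinates need no Jacobian
  factor.\<close>

lemma distr_cmod_square:
  "distr lborel borel (\<lambda>z::complex. (cmod z)\<^sup>2) = density lborel (\<lambda>u. ennreal pi * indicator {0..} u)"
proof (rule measure_eqI_generator_eq_countable[where E="range atMost" and A = "range (\<lambda>n::nat. {..real n})"])
  show "sets (distr lborel borel (\<lambda>z::complex. (cmod z)\<^sup>2)) = sigma_sets UNIV (range atMost)"
    by (simp add: borel_eq_atMost)
  show "sets (density lborel (\<lambda>u. ennreal pi * indicator {0..} u)) = sigma_sets UNIV (range (atMost::real \<Rightarrow> _))"
    by (simp add: borel_eq_atMost)
  have e1: "emeasure (distr lborel borel (\<lambda>z::complex. (cmod z)\<^sup>2)) {..x} = ennreal (pi * max x 0)" for x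
  proof -
    have "(\<lambda>z::complex. (cmod z)\<^sup>2) -` {..x} = (if x < 0 then {} else cball 0 (sqrt x))"
    proof (cases "x < 0")
      case False
      then show ?thesis by (auto simp: real_le_rsqrt) (metis norm_ge_zero not_less power_mono real_sqrt_pow2)
    next
      case True
      then have "\<not> (cmod z)\<^sup>2 \<le> x" for z using zero_le_power2[of "cmod z"] by linarith
      then show ?thesis using True by auto
    qed
    then show ?thesis
      by (subst emeasure_distr) (auto simp: emeasure_cball unit_ball_vol_2 max_def)
  qed
  have e2: "emeasure (density lborel (\<lambda>u. ennreal pi * indicator {0..} u)) {..x} = ennreal (pi * max x 0)" for x
  proof -
    have "emeasure (density lborel (\<lambda>u. ennreal pi * indicator {0..} u)) {..x} = 
      (\<integral>\<^sup>+u. ennreal pi * indicator ({0..x}) u \<partial>lborel)"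
      by (subst emeasure_density) (auto intro!: nn_integral_cong simp: indicator_def)
    also have "\<dots> = ennreal (pi * max x 0)"
      by (subst nn_integral_cmult_indicator) (auto simp: max_def ennreal_mult not_le emeasure_lborel_Icc_eq)
    finally show ?thesis .
  qed
  show "emeasure (distr lborel borel (\<lambda>z::complex. (cmod z)\<^sup>2)) X =
         emeasure (density lborel (\<lambda>u. ennreal pi * indicator {0..} u)) X" if "X \<in> range atMost" for X
    using that e1 e2 by auto
  show "emeasure (distr lborel borel (\<lambda>z::complex. (cmod z)\<^sup>2)) a \<noteq> \<infinity>" if "a \<in> range (\<lambda>n::nat. {..real n})" for a
    using that by (auto simp: e1)
  show "\<Union> (range (\<lambda>n::nat. {..real n})) = UNIV"
    by (auto intro: real_arch_simple)
qed (auto simp: Int_stable_def)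

lemma integral_radial_complex:
  fixes h :: "real \<Rightarrow> 'a::{banach,second_countable_topology}"
  assumes [measurable]: "h \<in> borel_measurable borel"
  shows "integrable lborel (\<lambda>z::complex. h ((cmod z)\<^sup>2)) \<longleftrightarrow> set_integrable lborel {0..} h" (is "?A")
    and "(LINT z|lborel. h ((cmod (z::complex))\<^sup>2)) = pi *\<^sub>R (LINT u:{0..}|lborel. h u)" (is "?B")
proof -
  have d: "ennreal pi * indicator {0..} u = ennreal (pi * indicator {0..} u)" for u :: real
    by (auto simp: indicator_def)
  have scale: "integrable lborel (\<lambda>u. pi *\<^sub>R g u) \<longleftrightarrow> integrable lborel g" for g :: "real \<Rightarrow> 'a"
    using integrable_scaleR_right[of "1 / pi" lborel "\<lambda>u. pi *\<^sub>R g u"] integrable_scaleR_right[of pi lborel g]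
    by auto
  have "integrable lborel (\<lambda>z::complex. h ((cmod z)\<^sup>2)) \<longleftrightarrow>
     integrable (distr lborel borel (\<lambda>z::complex. (cmod z)\<^sup>2)) h"
    by (subst integrable_distr_eq) auto
  also have "\<dots> \<longleftrightarrow> integrable lborel (\<lambda>u. (pi * indicator {0..} u) *\<^sub>R h u)"
    unfolding distr_cmod_square d by (subst integrable_density) auto
  also have "\<dots> \<longleftrightarrow> set_integrable lborel {0..} h"
    unfolding set_integrable_def scaleR_scaleR[symmetric] by (rule scale)
  finally show ?A .
  have "(LINT z|lborel. h ((cmod (z::complex))\<^sup>2)) = integral\<^sup>L (distr lborel borel (\<lambda>z::complex. (cmod z)\<^sup>2)) h"
    by (subst integral_distr) auto
  also have "\<dots> = (\<integral>u. (pi * indicator {0..} u) *\<^sub>R h u \<partial>lborel)"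
    unfolding distr_cmod_square d by (subst integral_density) auto
  also have "\<dots> = pi *\<^sub>R (LINT u:{0..}|lborel. h u)"
    unfolding set_lebesgue_integral_def scaleR_scaleR[symmetric] by (rule integral_scaleR_right)
  finally show ?B .
qed

lemma nn_integral_radial_complex:
  fixes h :: "real \<Rightarrow> ennreal"
  assumes [measurable]: "h \<in> borel_measurable borel"
  shows "(\<integral>\<^sup>+z. h ((cmod (z::complex))\<^sup>2) \<partial>lborel) = pi * (\<integral>\<^sup>+u\<in>{0..}. h u \<partial>lborel)"
proof -
  have "(\<integral>\<^sup>+z. h ((cmod (z::complex))\<^sup>2) \<partial>lborel) = integral\<^sup>N (distr lborel borel (\<lambda>z::complex. (cmod z)\<^sup>2)) h"
    by (subst nn_integral_distr) auto
  also have "\<dots> = (\<integral>\<^sup>+u. pi * (h u * indicator {0..} u) \<partial>lborel)"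
    unfolding distr_cmod_square by (subst nn_integral_density) (auto simp: mult_ac)
  finally show ?thesis by (simp add: nn_integral_cmult)
qed

lemma nn_integral_lborel_translate:
  fixes f :: "'a::euclidean_space \<Rightarrow> ennreal"
  assumes [measurable]: "f \<in> borel_measurable borel"
  shows "(\<integral>\<^sup>+x. f (a + x) \<partial>lborel) = (\<integral>\<^sup>+x. f x \<partial>lborel)"
proof -
  have "(\<integral>\<^sup>+x. f x \<partial>lborel) = (\<integral>\<^sup>+x. f x \<partial>distr lborel borel ((+) a))"
    by (simp add: lborel_distr_plus)
  also have "\<dots> = (\<integral>\<^sup>+x. f (a + x) \<partial>lborel)" by (subst nn_integral_distr) auto
  finally show ?thesis ..
qed

lemma nn_integral_lborel_complex:
  fixes f :: "complex \<Rightarrow> ennreal"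
  assumes [measurable]: "f \<in> borel_measurable borel"
  shows "(\<integral>\<^sup>+z. f z \<partial>lborel) = (\<integral>\<^sup>+y. \<integral>\<^sup>+x. f (Complex x y) \<partial>lborel \<partial>lborel)"
proof -
  have [measurable]: "(\<lambda>p::real\<times>real. Complex (fst p) (snd p)) \<in> borel_measurable borel"
    by (intro borel_measurable_continuous_onI) (auto simp: Complex_eq intro!: continuous_intros)
  have [measurable]: "(\<lambda>p::real\<times>real. Complex (fst p) (snd p)) \<in> borel_measurable (lborel \<Otimes>\<^sub>M lborel)"
    by (simp add: lborel_prod)
  have "(\<integral>\<^sup>+z. f z \<partial>lborel) = (\<integral>\<^sup>+z. f z \<partial>distr lborel borel (\<lambda>p::real\<times>real. Complex (fst p) (snd p)))"
    unfolding lborel_complex_eq_distr_prod ..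
  also have "\<dots> = (\<integral>\<^sup>+p. f (Complex (fst p) (snd p)) \<partial>(lborel \<Otimes>\<^sub>M lborel))"
    unfolding lborel_prod by (subst nn_integral_distr) auto
  also have "\<dots> = (\<integral>\<^sup>+y. \<integral>\<^sup>+x. f (Complex x y) \<partial>lborel \<partial>lborel)"
    by (subst lborel_pair.nn_integral_snd[symmetric]) auto
  finally show ?thesis .
qed

section \<open>Bounded holomorphic functions on a half plane\<close>

lemma shows integrable_inverse_square_plus: "b > 0 \<Longrightarrow> integrable lborel (\<lambda>t::real. 1 / ((t - a)\<^sup>2 + b\<^sup>2))"
    and integral_inverse_square_plus: "b > 0 \<Longrightarrow> (LINT t|lborel. 1 / ((t - a)\<^sup>2 + b\<^sup>2)) = pi / b"
proof -
  assume b: "b > 0"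
  let ?F = "\<lambda>t. arctan ((t - a) / b) / b" and ?f = "\<lambda>t::real. 1 / ((t - a)\<^sup>2 + b\<^sup>2)"
  have pos: "(t - a)\<^sup>2 + b\<^sup>2 > 0" for t using b by (simp add: add_nonneg_pos)
  have 1: "DERIV ?F t :> ?f t" for t
  proof -
    have *: "1 + ((t - a) / b)\<^sup>2 = ((t - a)\<^sup>2 + b\<^sup>2) / b\<^sup>2"
      using b by (simp add: power_divide add_divide_distrib)
    have w: "inverse (Q / b\<^sup>2) * (1 / b) / b = 1 / Q" if "Q \<noteq> 0" for Q
      using b that by (simp add: power2_eq_square)
    have "inverse (1 + ((t - a) / b)\<^sup>2) * (1 / b) / b = ?f t"
      unfolding * by (rule w) (use pos[of t] b in simp)
    moreover have "DERIV ?F t :> inverse (1 + ((t - a) / b)\<^sup>2) * (1 / b) / b"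
      using b by (auto intro!: derivative_eq_intros)
    ultimately show ?thesis by simp
  qed
  have 2: "isCont ?f t" for t
    using pos[of t] by (intro continuous_intros) auto
  have B: "((?F \<circ> real_of_ereal) \<longlongrightarrow> (pi / 2) / b) (at_left \<infinity>)"
    unfolding at_left_PInf filterlim_filtermap comp_def real_of_ereal.simps
    using b by (intro tendsto_divide tendsto_const filterlim_compose[OF tendsto_arctan_at_top]) (auto, real_asymp)
  have A: "((?F \<circ> real_of_ereal) \<longlongrightarrow> (- (pi / 2)) / b) (at_right (-\<infinity>))"
    unfolding at_right_MInf filterlim_filtermap comp_def real_of_ereal.simps
    using b by (intro tendsto_divide tendsto_const filterlim_compose[OF tendsto_arctan_at_bot]) (auto, real_asymp)
  note FTC = interval_integral_FTC_nonneg[of "-\<infinity>" \<infinity> ?F ?f, OF _ 1 2 _ A B]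
  have s: "set_integrable lborel (einterval (-\<infinity>) \<infinity>) ?f"
    by (rule FTC) (auto intro!: AE_I2 simp: less_imp_le[OF pos])
  have i: "(LBINT x=-\<infinity>..\<infinity>. ?f x) = (pi / 2) / b - (- (pi / 2)) / b"
    by (rule FTC) (auto intro!: AE_I2 simp: less_imp_le[OF pos])
  have U: "einterval (-\<infinity>) \<infinity> = UNIV" by (auto simp: einterval_def)
  show "integrable lborel ?f" using s unfolding U set_integrable_def by simp
  show "(LINT t|lborel. ?f t) = pi / b"
    using i b unfolding interval_lebesgue_integral_def U set_lebesgue_integral_def by (simp add: field_simps)
qed

lemma nn_integral_inverse_square_plus:
  assumes "b > 0"
  shows "(\<integral>\<^sup>+t. ennreal (1 / ((t - a)\<^sup>2 + b\<^sup>2)) \<partial>lborel) = ennreal (pi / b)"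
  using assms by (subst nn_integral_eq_integral)
    (auto simp: integrable_inverse_square_plus integral_inverse_square_plus)

text \<open>A convex domain carries a primitive \<open>G\<close>, and \<open>G r - G (- r)\<close>
  is at once the integral over the segment and over the upper half circle. Quadratic decay beats the
  arc length pi r, so the difference tends to zero. Working with \<open>G\<close> avoids assembling
  a closed contour.\<close>

lemma half_plane_integral_zero:
  assumes hol: "g holomorphic_on {z. Im z > - e}" and e: "e > 0"
    and bound: "\<forall>z. Im z \<ge> 0 \<and> cmod z \<ge> R \<longrightarrow> cmod (g z) \<le> C / (cmod z)\<^sup>2" and R: "R > 0"
  shows "integrable lborel (\<lambda>t. g (complex_of_real t))"
    and "(LINT t|lborel. g (complex_of_real t)) = 0"
proof -
  let ?S = "{z. Im z > - e}"
  have cS: "convex ?S" "open ?S" by (auto simp: convex_halfspace_Im_gt open_halfspace_Im_gt)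
  have contg: "continuous_on ?S g" by (rule holomorphic_on_imp_continuous_on[OF hol])
  have cont: "continuous_on UNIV (\<lambda>t. g (complex_of_real t))"
    by (rule continuous_on_compose2[OF contg]) (auto intro!: continuous_intros simp: e)
  have C: "C \<ge> 0"
    using order_trans[OF norm_ge_zero bound[rule_format, of "of_real R"]] R by (auto simp: zero_le_divide_iff)
  have "compact ((\<lambda>t. g (complex_of_real t)) ` {-R..R})"
    by (intro compact_continuous_image continuous_on_subset[OF cont]) auto
  then obtain B where B: "\<And>t. t \<in> {-R..R} \<Longrightarrow> cmod (g (complex_of_real t)) \<le> B"
    using compact_imp_bounded by (fastforce simp: bounded_iff)
  have B0: "B \<ge> 0" using order_trans[OF norm_ge_zero B[of 0]] R by simp
  \<comment> \<open>The first summand handles the compact part, where \<open>B\<close> bounds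
    \<open>g\<close>; the second handles |t| > R, where 1 + t^2 is at most t^2 (1 + 1/R^2).\<close>
  define M where "M = B * (1 + R\<^sup>2) + C * (1 + 1 / R\<^sup>2)"
  have M: "cmod (g (complex_of_real t)) \<le> M * (1 / ((t - 0)\<^sup>2 + 1\<^sup>2))" for t
  proof (cases "\<bar>t\<bar> \<le> R")
    case True
    then have "t\<^sup>2 \<le> R\<^sup>2" by (metis abs_ge_zero power2_abs power_mono)
    then have "B * (1 + t\<^sup>2) \<le> B * (1 + R\<^sup>2)" using B0 by (intro mult_left_mono) auto
    moreover have "0 \<le> C * (1 + 1 / R\<^sup>2)" using C by (intro mult_nonneg_nonneg) auto
    ultimately have "B * (1 + t\<^sup>2) \<le> M" unfolding M_def by linarith
    then have "B \<le> M / (1 + t\<^sup>2)" by (subst pos_le_divide_eq) (auto simp: add_pos_nonneg)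
    moreover have "cmod (g (of_real t)) \<le> B" using B[of t] True by (simp add: abs_le_iff)
    ultimately show ?thesis by (simp add: add.commute)
  next
    case False
    then have t: "R\<^sup>2 \<le> t\<^sup>2" "t\<^sup>2 > 0"
      using R by (auto simp: abs_le_square_iff[symmetric])
    have "1 / t\<^sup>2 \<le> 1 / R\<^sup>2" using t R by (intro divide_left_mono) auto
    then have "C * (1 + 1 / t\<^sup>2) \<le> C * (1 + 1 / R\<^sup>2)" using C by (intro mult_left_mono) auto
    moreover have "0 \<le> B * (1 + R\<^sup>2)" using B0 by (intro mult_nonneg_nonneg) auto
    ultimately have "C * (1 + 1 / t\<^sup>2) \<le> M" unfolding M_def by linarith
    then have "C / t\<^sup>2 * (1 + t\<^sup>2) \<le> M" using t by (simp add: field_simps)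
    then have "C / t\<^sup>2 \<le> M / (1 + t\<^sup>2)" by (subst pos_le_divide_eq) (auto simp: add_pos_nonneg)
    then show ?thesis using bound[rule_format, of "of_real t"] False by (auto simp: add.commute)
  qed
  have im: "integrable lborel (\<lambda>t. M * (1 / ((t - 0)\<^sup>2 + 1\<^sup>2)))"
    by (intro integrable_mult_right integrable_inverse_square_plus) auto
  have meas[measurable]: "(\<lambda>t. g (complex_of_real t)) \<in> borel_measurable lborel"
    using cont by (auto intro: borel_measurable_continuous_onI)
  show int: "integrable lborel (\<lambda>t. g (complex_of_real t))"
    by (rule Bochner_Integration.integrable_bound[OF im meas]) (auto intro!: AE_I2 order_trans[OF M] divide_right_mono)
  obtain G where G: "\<And>z. z \<in> ?S \<Longrightarrow> (G has_field_derivative g z) (at z)"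
    using holomorphic_convex_primitive'[OF cS hol] cS by (metis at_within_open)
  have arc: "cmod (G (of_real r) - G (- of_real r)) \<le> C * pi / r" if r: "r \<ge> R" for r
  proof -
    have r0: "r > 0" using r R by simp
    have im: "Im z \<ge> 0 \<and> cmod z = r" if "z \<in> path_image (part_circlepath 0 r 0 pi)" for z
      using that r0 by (auto simp: path_image_part_circlepath Im_exp norm_mult intro!: sin_ge_zero mult_nonneg_nonneg)
    have "(g has_contour_integral (G (pathfinish (part_circlepath 0 r 0 pi)) - G (pathstart (part_circlepath 0 r 0 pi))))
       (part_circlepath 0 r 0 pi)"
      by (rule contour_integral_primitive[of ?S])
        (use im e in \<open>fastforce intro: has_field_derivative_at_within[OF G]\<close>)+
    then have "cmod (G (pathfinish (part_circlepath 0 r 0 pi)) - G (pathstart (part_circlepath 0 r 0 pi)))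
      \<le> C / r\<^sup>2 * r * (pi - 0)"
      by (rule has_contour_integral_bound_part_circlepath) (use r0 C im bound r in \<open>force\<close>)+
    then show ?thesis using r0 by (simp add: norm_minus_commute power2_eq_square field_simps)
  qed
  have seg: "(LINT t:{-r..r}|lborel. g (of_real t)) = G (of_real r) - G (- of_real r)" if "r \<ge> 0" for r
  proof -
    have "((\<lambda>t. G (of_real t)) has_vector_derivative g (of_real t)) (at t within {-r..r})" for t
      using has_vector_derivative_real_field[OF G[of "of_real t"]] e
      by (auto intro: has_vector_derivative_real_field)
    then have "((\<lambda>t. g (of_real t)) has_integral (G (of_real r) - G (of_real (-r)))) {-r..r}"
      using that by (intro fundamental_theorem_of_calculus) auto
    moreover have "set_integrable lborel {-r..r} (\<lambda>t. g (of_real t))"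
      using int unfolding set_integrable_def by (intro integrable_mult_indicator) auto
    ultimately show ?thesis
      by (simp add: set_borel_integral_eq_integral(2) integral_unique)
  qed
  have "(\<lambda>n. LINT t|lborel. indicator {-real n..real n} t *\<^sub>R g (of_real t)) \<longlonglongrightarrow> (LINT t|lborel. g (of_real t))"
  proof (rule integral_dominated_convergence[where w="\<lambda>t. cmod (g (of_real t))"])
    show "AE x in lborel. (\<lambda>n. indicator {-real n..real n} x *\<^sub>R g (of_real x)) \<longlonglongrightarrow> g (of_real x)"
    proof (rule AE_I2)
      fix x :: real
      obtain N where N: "\<bar>x\<bar> \<le> real N" using real_arch_simple by blast
      show "(\<lambda>n. indicator {-real n..real n} x *\<^sub>R g (of_real x)) \<longlonglongrightarrow> g (of_real x)"
        by (rule tendsto_eventually, rule eventually_sequentiallyI[of N]) (use N in \<open>auto simp: indicator_def\<close>)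
    qed
  qed (use int in \<open>auto intro!: AE_I2 simp: indicator_def\<close>)
  then have lim: "(\<lambda>n. G (of_real (real n)) - G (- of_real (real n))) \<longlonglongrightarrow> (LINT t|lborel. g (of_real t))"
    using seg unfolding set_lebesgue_integral_def by simp
  have "(\<lambda>n. G (of_real (real n)) - G (- of_real (real n))) \<longlonglongrightarrow> 0"
  proof (rule Lim_null_comparison)
    obtain N where N: "R \<le> real N" using real_arch_simple by blast
    show "\<forall>\<^sub>F n in sequentially. cmod (G (of_real (real n)) - G (- of_real (real n))) \<le> C * pi / real n"
      by (rule eventually_sequentiallyI[of N], rule arc) (use N in simp)
    show "(\<lambda>n. C * pi / real n) \<longlonglongrightarrow> 0" by real_asymp
  qed
  with lim show "(LINT t|lborel. g (complex_of_real t)) = 0" using LIMSEQ_unique by blast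
qed

section \<open>Poisson and Cauchy formulas on a horizontal line\<close>

lemma
  assumes a: "Im a > 0"
  shows integrable_poisson_kernel: "integrable lborel (\<lambda>t. 1 / ((of_real t - a) * (of_real t - cnj a)))"
    and integral_poisson_kernel: "(LINT t|lborel. 1 / ((of_real t - a) * (of_real t - cnj a))) = of_real (pi / Im a)"
proof -
  have eq: "1 / ((of_real t - a) * (of_real t - cnj a)) = complex_of_real (1 / ((t - Re a)\<^sup>2 + (Im a)\<^sup>2))" for t
  proof -
    have "(of_real t - a) * (of_real t - cnj a) = complex_of_real ((t - Re a)\<^sup>2 + (Im a)\<^sup>2)"
      by (auto simp: complex_eq_iff power2_eq_square algebra_simps)
    then show ?thesis by (simp only: of_real_divide of_real_1)
  qed
  show "integrable lborel (\<lambda>t. 1 / ((of_real t - a) * (of_real t - cnj a)))"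
    unfolding eq by (intro integrable_of_real integrable_inverse_square_plus a)
  show "(LINT t|lborel. 1 / ((of_real t - a) * (of_real t - cnj a))) = of_real (pi / Im a)"
    unfolding eq integral_complex_of_real by (simp add: integral_inverse_square_plus a)
qed

text \<open>The double pole \<open>a\<close> lies in the upper half plane, where the vanishing
  result cannot be applied directly. On the real line, conjugation moves the pole to
  \<open>cnj a\<close>, below the line; the quadratic decay is kept.\<close>

lemma
  assumes a: "Im a > 0"
  shows integrable_inverse_square: "integrable lborel (\<lambda>t. 1 / (of_real t - a)\<^sup>2)"
    and integral_inverse_square: "(LINT t|lborel. 1 / (of_real t - a)\<^sup>2) = 0"
proof -
  have h: "(\<lambda>z. 1 / (z - cnj a)\<^sup>2) holomorphic_on {z. Im z > - Im a}"
    by (intro holomorphic_intros) auto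
  have b: "\<forall>z. Im z \<ge> 0 \<and> cmod z \<ge> 2 * cmod a + 1 \<longrightarrow> cmod (1 / (z - cnj a)\<^sup>2) \<le> 4 / (cmod z)\<^sup>2"
  proof (intro allI impI)
    fix z assume that': "Im z \<ge> 0 \<and> cmod z \<ge> 2 * cmod a + 1"
    then have that: "cmod z \<ge> 2 * cmod a + 1" by simp
    have "cmod z / 2 \<le> cmod (z - cnj a)" using norm_triangle_ineq2[of z "cnj a"] that by simp
    then have "(cmod z / 2)\<^sup>2 \<le> (cmod (z - cnj a))\<^sup>2" by (intro power_mono) auto
    moreover have "cmod z > 0" using that norm_ge_zero[of a] by linarith
    ultimately have "1 / (cmod (z - cnj a))\<^sup>2 \<le> 1 / (cmod z / 2)\<^sup>2"
      by (intro divide_left_mono mult_pos_pos) (auto intro: less_le_trans[rotated])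
    then show "cmod (1 / (z - cnj a)\<^sup>2) \<le> 4 / (cmod z)\<^sup>2" by (simp add: norm_divide norm_power power_divide)
  qed
  have R: "2 * cmod a + 1 > 0" by (simp add: add_nonneg_pos)
  note H = half_plane_integral_zero[OF h a b R]
  have eq: "1 / (of_real t - a)\<^sup>2 = cnj (1 / (of_real t - cnj a)\<^sup>2)" for t :: real by simp
  show "integrable lborel (\<lambda>t. 1 / (of_real t - a)\<^sup>2)"
    unfolding eq using H(1) by (subst integrable_cnj) auto
  show "(LINT t|lborel. 1 / (of_real t - a)\<^sup>2) = 0"
  proof -
    have "(LINT t|lborel. 1 / (of_real t - a)\<^sup>2) = (LINT t|lborel. cnj (1 / (of_real t - cnj a)\<^sup>2))"
      by (simp only: eq)
    also have "\<dots> = cnj (LINT t|lborel. 1 / (of_real t - cnj a)\<^sup>2)"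
      by (rule Bochner_Integration.integral_cnj)
    also have "\<dots> = 0" by (subst H(2)) simp
    finally show ?thesis .
  qed
qed

text \<open>A bounded \<open>f\<close> leaves no decay to spare, so the pole is removed by
  subtraction instead of closing a contour around it. After subtracting \<open>f a\<close>, the
  quotient by (z - a)(z - cnj a) is holomorphic above the line and decays quadratically, so only a
  multiple of the Poisson kernel contributes.\<close>

lemma
  assumes hol: "f holomorphic_on {z. Im z > - e}" and e: "e > 0"
    and bd: "\<forall>z. Im z > - e \<longrightarrow> cmod (f z) \<le> M" and a: "Im a > 0"
  shows poisson_integrable: "integrable lborel (\<lambda>t. f (of_real t) / ((of_real t - a) * (of_real t - cnj a)))"
    and poisson_integral: "(LINT t|lborel. f (of_real t) / ((of_real t - a) * (of_real t - cnj a))) = f a * of_real (pi / Im a)"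
    and cauchy_deriv_integral: "(LINT t|lborel. f (of_real t) / (of_real t - a)\<^sup>2) = 2 * pi * \<i> * deriv f a"
proof -
  \<comment> \<open>Bounding \<open>d\<close> by \<open>Im a\<close> keeps \<open>cnj a\<close>
    outside the half plane, so that division by \<open>z - cnj a\<close> is harmless there.\<close>
  define d where "d = min e (Im a)"
  have d: "d > 0" "d \<le> e" "d \<le> Im a" using e a by (auto simp: d_def)
  let ?S = "{z. Im z > - d}"
  have S: "open ?S" by (rule open_halfspace_Im_gt)
  have hf: "f holomorphic_on ?S" by (rule holomorphic_on_subset[OF hol]) (use d in auto)
  define q where "q z = (if z = a then deriv f a else (f z - f a) / (z - a))" for z
  have q: "q holomorphic_on ?S" unfolding q_def by (rule pole_lemma_open[OF hf S])
  \<comment> \<open>\<open>h\<close> is corrected to vanish at \<open>a\<close>: a further division by \<open>z - a\<close> leaves a function that is holomorphic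
    on the half plane and decays quadratically, although \<open>f\<close> is only bounded.\<close>
  define h where "h z = q z - q a * (a - cnj a) / (z - cnj a)" for z
  have h: "h holomorphic_on ?S" unfolding h_def
    using d by (intro holomorphic_intros q) auto
  have ac: "a - cnj a \<noteq> 0" using a by (auto simp: complex_eq_iff)
  then have ha: "h a = 0" by (simp add: h_def)
  define g where "g z = (if z = a then deriv h a else (h z - h a) / (z - a))" for z
  have g: "g holomorphic_on ?S" unfolding g_def by (rule pole_lemma_open[OF h S])
  have M: "M \<ge> 0" using order_trans[OF norm_ge_zero bd[rule_format, of a]] a e by simp
  define R where "R = 2 * cmod a + 1"
  have R: "R > 0" by (simp add: R_def add_nonneg_pos)
  have far: "cmod z > 0" "z \<noteq> a" "z \<noteq> cnj a" "cmod z / 2 \<le> cmod (z - a)" "cmod z / 2 \<le> cmod (z - cnj a)" if "cmod z \<ge> R" for z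
    using that norm_triangle_ineq2[of z a] norm_triangle_ineq2[of z "cnj a"] norm_ge_zero[of a] unfolding R_def
    by (auto simp del: norm_ge_zero)
  have far2: "cmod (u / ((z - b) * (z - c))) \<le> 4 * K / (cmod z)\<^sup>2" 
    if "cmod z \<ge> R" "cmod u \<le> K" "b = a \<or> b = cnj a" "c = a \<or> c = cnj a" for z u K b c
  proof -
    have "cmod z / 2 \<le> cmod (z - b)" "cmod z / 2 \<le> cmod (z - c)" "cmod z > 0" using that far[of z] by auto
    then have "(cmod z / 2) * (cmod z / 2) \<le> cmod (z - b) * cmod (z - c)" by (intro mult_mono) auto
    then have "cmod u / (cmod (z - b) * cmod (z - c)) \<le> K / ((cmod z / 2) * (cmod z / 2))"
      using that \<open>cmod z > 0\<close> by (intro frac_le) (auto intro: order_trans[OF norm_ge_zero])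
    then show ?thesis by (simp add: norm_divide norm_mult power2_eq_square mult_ac)
  qed
  have fb: "cmod (f z - f a) \<le> 2 * M" if "Im z \<ge> 0" for z
    using norm_triangle_ineq4[of "f z" "f a"] bd[rule_format, of z] bd[rule_format, of a] that a e by simp
  have nr: "of_real t \<noteq> a" "of_real t \<noteq> cnj a" for t
    using a by (auto simp: complex_eq_iff)

  have k: "(\<lambda>z. q z / (z - cnj a)) holomorphic_on ?S"
    using d by (intro holomorphic_intros q) auto
  have kb: "\<forall>z. Im z \<ge> 0 \<and> cmod z \<ge> R \<longrightarrow> cmod (q z / (z - cnj a)) \<le> 4 * (2 * M) / (cmod z)\<^sup>2"
  proof (intro allI impI)
    fix z assume z: "Im z \<ge> 0 \<and> cmod z \<ge> R"
    then have "q z / (z - cnj a) = (f z - f a) / ((z - a) * (z - cnj a))"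
      using far[of z] by (simp add: q_def)
    also have "cmod \<dots> \<le> 4 * (2 * M) / (cmod z)\<^sup>2"
      using far2[of z "f z - f a" "2 * M" a "cnj a"] fb z by blast
    finally show "cmod (q z / (z - cnj a)) \<le> 4 * (2 * M) / (cmod z)\<^sup>2" .
  qed
  note K = half_plane_integral_zero[OF k d(1) kb R]
  have eqP: "f (of_real t) / ((of_real t - a) * (of_real t - cnj a)) =
     q (of_real t) / (of_real t - cnj a) + f a * (1 / ((of_real t - a) * (of_real t - cnj a)))" for t
    using nr[of t] by (simp add: q_def divide_simps)
  show "integrable lborel (\<lambda>t. f (of_real t) / ((of_real t - a) * (of_real t - cnj a)))"
    unfolding eqP using K(1) by (intro Bochner_Integration.integrable_add integrable_mult_right integrable_poisson_kernel[OF a])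
  show "(LINT t|lborel. f (of_real t) / ((of_real t - a) * (of_real t - cnj a))) = f a * of_real (pi / Im a)"
    unfolding eqP by (subst Bochner_Integration.integral_add, rule K(1), intro integrable_mult_right integrable_poisson_kernel[OF a])
      (simp only: integral_mult_right_zero integral_poisson_kernel[OF a] add_0_left K(2))

  have gb: "cmod (g z) \<le> 4 * (2 * M + cmod (q a * (a - cnj a))) / (cmod z)\<^sup>2" if "Im z \<ge> 0" "cmod z \<ge> R" for z
  proof -
    have "g z = (f z - f a) / ((z - a) * (z - a)) - (q a * (a - cnj a)) / ((z - cnj a) * (z - a))"
      using far[of z] that ac by (simp add: g_def ha h_def q_def diff_divide_distrib)
    also have "cmod \<dots> \<le> 4 * (2 * M) / (cmod z)\<^sup>2 + 4 * cmod (q a * (a - cnj a)) / (cmod z)\<^sup>2"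
      using far2[of z "f z - f a" "2 * M" a a] far2[of z "q a * (a - cnj a)" _ "cnj a" a] fb that
      by (intro order_trans[OF norm_triangle_ineq4] add_mono) auto
    finally show ?thesis by (simp add: add_divide_distrib distrib_left)
  qed
  have gb': "\<forall>z. Im z \<ge> 0 \<and> cmod z \<ge> R \<longrightarrow> cmod (g z) \<le> 4 * (2 * M + cmod (q a * (a - cnj a))) / (cmod z)\<^sup>2"
    using gb by blast
  note G = half_plane_integral_zero[OF g d(1) gb' R]
  \<comment> \<open>Of the three terms only the Poisson kernel has a nonzero integral. Its
    coefficient is f'(a) * 2i Im a, and its mass pi / Im a turns this into 2 pi i f'(a).\<close>
  have eqC: "f (of_real t) / (of_real t - a)\<^sup>2 = g (of_real t) + f a * (1 / (of_real t - a)\<^sup>2) +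
      (q a * (a - cnj a)) * (1 / ((of_real t - a) * (of_real t - cnj a)))" for t
    using nr[of t] ac by (simp add: g_def ha h_def q_def diff_divide_distrib power2_eq_square)
  have "(LINT t|lborel. f (of_real t) / (of_real t - a)\<^sup>2) = 0 + f a * 0 + (q a * (a - cnj a)) * of_real (pi / Im a)"
    unfolding eqC by (subst Bochner_Integration.integral_add, (intro Bochner_Integration.integrable_add integrable_mult_right integrable_poisson_kernel[OF a]
      integrable_inverse_square[OF a] G(1))+)+ (simp only: integral_mult_right_zero integral_inverse_square[OF a] integral_poisson_kernel[OF a] G(2))
  also have "\<dots> = 2 * pi * \<i> * deriv f a"
    using a by (simp add: q_def complex_diff_cnj field_simps)
  finally show "(LINT t|lborel. f (of_real t) / (of_real t - a)\<^sup>2) = 2 * pi * \<i> * deriv f a" .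
qed

text \<open>The normalized Poisson kernel depends on (t - x)^2 only, so it has mass one in
  \<open>x\<close> as well as in \<open>t\<close>. Integrating the pointwise domination over
  \<open>x\<close> and exchanging the integrals thus loses nothing. No square integrability enters:
  the right-hand side may be infinite.\<close>

lemma half_plane_L2_decreasing:
  assumes hol: "f holomorphic_on {z. Im z > - e}" and e: "e > 0"
    and bd: "\<forall>z. Im z > - e \<longrightarrow> cmod (f z) \<le> M" and d: "d > 0"
  shows "(\<integral>\<^sup>+x. ennreal ((cmod (f (of_real x + \<i> * of_real d)))\<^sup>2) \<partial>lborel) \<le> (\<integral>\<^sup>+t. ennreal ((cmod (f (of_real t)))\<^sup>2) \<partial>lborel)"
proof -
  have contf: "continuous_on {z. Im z > - e} f" by (rule holomorphic_on_imp_continuous_on[OF hol])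
  have [measurable]: "(\<lambda>t. f (complex_of_real t)) \<in> borel_measurable borel"
    by (rule borel_measurable_continuous_onI, rule continuous_on_compose2[OF contf]) (auto intro!: continuous_intros simp: e)
  have M: "M \<ge> 0" using order_trans[OF norm_ge_zero bd[rule_format, of 0]] e by simp
  have pw: "ennreal ((cmod (f (of_real x + \<i> * of_real d)))\<^sup>2) \<le>
     (\<integral>\<^sup>+t. ennreal (d / pi) * (ennreal ((cmod (f (of_real t)))\<^sup>2) * ennreal (1 / ((t - x)\<^sup>2 + d\<^sup>2))) \<partial>lborel)" (is "?l \<le> ?r") for x
  proof -
    define a where "a = of_real x + \<i> * of_real d"
    have a: "Im a > 0" "Im a = d" "Re a = x" using d by (auto simp: a_def)
    \<comment> \<open>Poisson's formula for \<open>f\<^sup>2\<close> instead of \<open>f\<close> makes Jensen's inequality unnecessary.\<close>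
    have h2: "(\<lambda>z. (f z)\<^sup>2) holomorphic_on {z. Im z > - e}" by (intro holomorphic_intros hol)
    have b2: "\<forall>z. Im z > - e \<longrightarrow> cmod ((f z)\<^sup>2) \<le> M\<^sup>2"
      using bd by (auto simp: norm_power intro!: power_mono)
    note P1 = poisson_integrable[OF h2 e b2 a(1)]
    have P2: "(f a)\<^sup>2 * of_real (pi / Im a) = (LINT t|lborel. (f (of_real t))\<^sup>2 / ((of_real t - a) * (of_real t - cnj a)))"
      by (rule poisson_integral[OF h2 e b2 a(1), symmetric])
    have n: "norm ((f (of_real t))\<^sup>2 / ((of_real t - a) * (of_real t - cnj a)))
       = (cmod (f (of_real t)))\<^sup>2 * (1 / ((t - x)\<^sup>2 + d\<^sup>2))" for t
    proof -
      have "(of_real t - a) * (of_real t - cnj a) = complex_of_real ((t - x)\<^sup>2 + d\<^sup>2)"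
        using a by (auto simp: complex_eq_iff power2_eq_square algebra_simps)
      then show ?thesis using d by (simp add: norm_divide norm_power add_nonneg_nonneg del: of_real_add of_real_power)
    qed
    have "(cmod (f a))\<^sup>2 * (pi / d) = norm ((f a)\<^sup>2 * of_real (pi / Im a))"
      using d a by (simp add: norm_mult norm_power norm_divide)
    also have "ennreal \<dots> \<le> (\<integral>\<^sup>+t. ennreal (norm ((f (of_real t))\<^sup>2 / ((of_real t - a) * (of_real t - cnj a)))) \<partial>lborel)"
      unfolding P2 by (rule integral_norm_bound_ennreal[OF P1])
    also have "\<dots> = (\<integral>\<^sup>+t. (ennreal ((cmod (f (of_real t)))\<^sup>2) * ennreal (1 / ((t - x)\<^sup>2 + d\<^sup>2))) \<partial>lborel)"
      unfolding n by (intro nn_integral_cong ennreal_mult) auto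
    finally have "ennreal (d / pi) * ennreal ((cmod (f a))\<^sup>2 * (pi / d)) \<le> ennreal (d / pi) * \<dots>"
      by (rule mult_left_mono) auto
    then show ?thesis using d
      by (subst nn_integral_cmult) (auto simp: ennreal_mult[symmetric] a_def)
  qed
  have "(\<integral>\<^sup>+x. ennreal ((cmod (f (of_real x + \<i> * of_real d)))\<^sup>2) \<partial>lborel) \<le>
    (\<integral>\<^sup>+x. \<integral>\<^sup>+t. ennreal (d / pi) * (ennreal ((cmod (f (of_real t)))\<^sup>2) * ennreal (1 / ((t - x)\<^sup>2 + d\<^sup>2))) \<partial>lborel \<partial>lborel)"
    by (intro nn_integral_mono pw)
  also have "\<dots> = (\<integral>\<^sup>+t. \<integral>\<^sup>+x. ennreal (d / pi) * (ennreal ((cmod (f (of_real t)))\<^sup>2) * ennreal (1 / ((t - x)\<^sup>2 + d\<^sup>2))) \<partial>lborel \<partial>lborel)"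
    by (rule lborel_pair.Fubini') measurable
  also have "\<dots> = (\<integral>\<^sup>+t. ennreal ((cmod (f (of_real t)))\<^sup>2) \<partial>lborel)"
  proof (intro nn_integral_cong)
    fix t
    have "(\<integral>\<^sup>+x. ennreal (d / pi) * (ennreal ((cmod (f (of_real t)))\<^sup>2) * ennreal (1 / ((t - x)\<^sup>2 + d\<^sup>2))) \<partial>lborel)
     = ennreal (d / pi) * (ennreal ((cmod (f (of_real t)))\<^sup>2) * ennreal (pi / d))"
      using nn_integral_inverse_square_plus[OF d, of t] by (simp add: nn_integral_cmult power2_commute)
    also have "\<dots> = ennreal ((cmod (f (of_real t)))\<^sup>2)"
      using d by (simp add: ennreal_mult[symmetric])
    finally show "(\<integral>\<^sup>+x. ennreal (d / pi) * (ennreal ((cmod (f (of_real t)))\<^sup>2) * ennreal (1 / ((t - x)\<^sup>2 + d\<^sup>2))) \<partial>lborel)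
     = ennreal ((cmod (f (of_real t)))\<^sup>2)" .
  qed
  finally show ?thesis .
qed

text \<open>Cauchy's formula for the rescaled function f(u z) on the unit circle in u. The rescaling
  treats all radii at once, including z = 0.\<close>

lemma holomorphic_circle_mean:
  assumes hol: "f holomorphic_on S" and S: "open S" "cball 0 r \<subseteq> S" and z: "cmod z \<le> r"
  shows "set_integrable lborel {0..1} (\<lambda>\<theta>. f (cis (2 * pi * \<theta>) * z))"
    and "(LINT \<theta>:{0..1}|lborel. f (cis (2 * pi * \<theta>) * z)) = f 0"
proof -
  define h where "h = (\<lambda>u. f (u * z))"
  have sub: "(\<lambda>u. u * z) ` cball 0 1 \<subseteq> S"
  proof -
    have "cmod (u * z) \<le> r" if "cmod u \<le> 1" for u
      using mult_mono[OF that z] by (simp add: norm_mult)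
    then show ?thesis using S by auto
  qed
  have h: "h holomorphic_on cball 0 1" unfolding h_def
    by (rule holomorphic_on_compose_gen[OF _ hol, unfolded comp_def]) (use sub in \<open>auto intro!: holomorphic_intros\<close>)
  have "((\<lambda>u. h u / (u - 0)) has_contour_integral (2 * of_real pi * \<i> * h 0)) (circlepath 0 1)"
    by (rule Cauchy_integral_circlepath_simple) (use h in auto)
  then have "((\<lambda>x. h (cis (2 * pi * x)) * (2 * pi * \<i>)) has_integral (2 * of_real pi * \<i> * h 0)) {0..1}"
    unfolding has_contour_integral_def
    by (rule has_integral_eq[rotated])
      (simp add: vector_derivative_circlepath01, simp add: circlepath cis_conv_exp mult_ac)
  from has_integral_mult_left[OF this, of "1 / (2 * pi * \<i>)"]
  have hi: "((\<lambda>x. h (cis (2 * pi * x))) has_integral h 0) {0..1}"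
    by simp
  have cisS: "cis x * z \<in> S" for x
    by (rule subsetD[OF sub], rule image_eqI[of _ _ "cis x"]) auto
  have "continuous_on {0..1} (\<lambda>\<theta>. f (cis (2 * pi * \<theta>) * z))"
    by (rule continuous_on_compose2[OF holomorphic_on_imp_continuous_on[OF hol]])
      (use cisS in \<open>auto intro!: continuous_intros\<close>)
  then show si: "set_integrable lborel {0..1} (\<lambda>\<theta>. f (cis (2 * pi * \<theta>) * z))"
    unfolding set_integrable_def by (intro borel_integrable_compact) auto
  show "(LINT \<theta>:{0..1}|lborel. f (cis (2 * pi * \<theta>) * z)) = f 0"
    using set_borel_integral_eq_integral(2)[OF si] hi by (simp add: h_def integral_unique)
qed

section \<open>Averaging over rotations and mean values\<close>

lemma measurable_cis [measurable]: "cis \<in> borel_measurable borel"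
  by (intro borel_measurable_continuous_onI) (auto intro!: continuous_intros)

lemma nn_integral_rotation:
  fixes H :: "complex \<Rightarrow> ennreal"
  assumes [measurable]: "H \<in> borel_measurable borel" and c: "cmod c = 1"
  shows "(\<integral>\<^sup>+u. H (c * u) \<partial>lborel) = (\<integral>\<^sup>+u. H u \<partial>lborel)"
proof -
  have "(\<integral>\<^sup>+u. H u \<partial>lborel) = (\<integral>\<^sup>+u. H u \<partial>distr lborel borel (\<lambda>u. c * u))"
    by (simp add: lborel_complex_rotation[OF c])
  also have "\<dots> = (\<integral>\<^sup>+u. H (c * u) \<partial>lborel)" by (subst nn_integral_distr) auto
  finally show ?thesis ..
qed

text \<open>Every rotated copy has the same integral, and the angles range over an interval of
  length one. This replaces integration in polar coordinates below.\<close>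

lemma nn_integral_rotation_average:
  fixes H :: "complex \<Rightarrow> ennreal"
  assumes [measurable]: "H \<in> borel_measurable borel"
  shows "(\<integral>\<^sup>+u. H u \<partial>lborel) = (\<integral>\<^sup>+u. (\<integral>\<^sup>+\<theta>\<in>{0..1}. H (cis (2 * pi * \<theta>) * u) \<partial>lborel) \<partial>lborel)"
proof -
  have "(\<integral>\<^sup>+u. H u \<partial>lborel) = (\<integral>\<^sup>+\<theta>\<in>{0..1::real}. (\<integral>\<^sup>+u. H u \<partial>lborel) \<partial>lborel)"
    by (simp add: nn_integral_cmult_indicator)
  also have "\<dots> = (\<integral>\<^sup>+\<theta>\<in>{0..1}. (\<integral>\<^sup>+u. H (cis (2 * pi * \<theta>) * u) \<partial>lborel) \<partial>lborel)"
    by (intro nn_integral_cong) (simp add: nn_integral_rotation)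
  also have "\<dots> = (\<integral>\<^sup>+\<theta>. (\<integral>\<^sup>+u. H (cis (2 * pi * \<theta>) * u) * indicator {0..1} \<theta> \<partial>lborel) \<partial>lborel)"
    by (intro nn_integral_cong) (simp add: nn_integral_multc)
  also have "\<dots> = (\<integral>\<^sup>+u. (\<integral>\<^sup>+\<theta>\<in>{0..1}. H (cis (2 * pi * \<theta>) * u) \<partial>lborel) \<partial>lborel)"
    by (rule lborel_pair.Fubini') measurable
  finally show ?thesis .
qed

text \<open>For complex integrands the exchange of integrals needs joint integrability in angle and
  point; it holds because each rotated copy has the same L1 norm. \<open>H0\<close> is given only as
  an angular mean, and its integrability is part of what Fubini's theorem yields.\<close>

lemma integral_rotation_average:
  fixes H :: "complex \<times> real \<Rightarrow> complex"
  assumes H: "integrable lborel H"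
    and H0: "\<And>u t. (LINT \<theta>:{0..1}|lborel. H (cis (2 * pi * \<theta>) * u, t)) = H0 (u, t)"
  shows "integrable lborel H0" and "(LINT p|lborel. H0 p) = (LINT p|lborel. H p)"
proof -
  have [measurable]: "H \<in> borel_measurable borel" using H by auto
  define T where "T = (\<lambda>\<theta> (p::complex \<times> real). (cis (2 * pi * \<theta>) * fst p, snd p))"
  have T[measurable]: "(\<lambda>x. T (fst x) (snd x)) \<in> borel_measurable (borel \<Otimes>\<^sub>M borel)"
    unfolding T_def borel_prod by (intro borel_measurable_continuous_onI) (auto intro!: continuous_intros)
  have T1[measurable]: "T \<theta> \<in> borel_measurable borel" for \<theta>
    unfolding T_def by (intro borel_measurable_continuous_onI) (auto intro!: continuous_intros)
  have dT: "distr lborel borel (T \<theta>) = lborel" for \<theta>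
  proof -
    have "distr (lborel \<Otimes>\<^sub>M lborel) (borel \<Otimes>\<^sub>M borel) (\<lambda>(x, y). (cis (2 * pi * \<theta>) * x, y :: real)) =
      distr lborel borel (\<lambda>x. cis (2 * pi * \<theta>) * x) \<Otimes>\<^sub>M distr lborel borel (\<lambda>y. y)"
      by (rule pair_measure_distr[symmetric]) (auto simp: distr_id2 lborel.sigma_finite_measure_axioms)
    then show ?thesis
      by (simp add: lborel_complex_rotation distr_id2 lborel_prod borel_prod T_def case_prod_beta')
  qed
  let ?G = "\<lambda>\<theta> p. indicator {0..1::real} \<theta> *\<^sub>R H (T \<theta> p)"
  have nT: "(\<integral>\<^sup>+p. ennreal (norm (H (T \<theta> p))) \<partial>lborel) = (\<integral>\<^sup>+p. ennreal (norm (H p)) \<partial>lborel)" for \<theta>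
    by (subst (2) dT[symmetric, of \<theta>], subst nn_integral_distr) auto
  have iT: "(LINT p|lborel. H (T \<theta> p)) = (LINT p|lborel. H p)" for \<theta>
    by (subst (2) dT[symmetric, of \<theta>], subst integral_distr) auto
  have G: "integrable (lborel \<Otimes>\<^sub>M lborel) (\<lambda>(\<theta>, p). ?G \<theta> p)"
  proof (rule integrableI_bounded)
    show "(\<lambda>(\<theta>, p). ?G \<theta> p) \<in> borel_measurable (lborel \<Otimes>\<^sub>M lborel)"
      unfolding case_prod_beta' by measurable
    have "(\<integral>\<^sup>+x. ennreal (norm (case x of (\<theta>, p) \<Rightarrow> ?G \<theta> p)) \<partial>(lborel \<Otimes>\<^sub>M lborel))
       = (\<integral>\<^sup>+\<theta>. \<integral>\<^sup>+p. ennreal (norm (?G \<theta> p)) \<partial>lborel \<partial>lborel)"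
      by (subst lborel.nn_integral_fst[symmetric]) (auto simp: case_prod_beta')
    also have "\<dots> = (\<integral>\<^sup>+\<theta>\<in>{0..1::real}. (\<integral>\<^sup>+p. ennreal (norm (H (T \<theta> p))) \<partial>lborel) \<partial>lborel)"
      by (intro nn_integral_cong) (auto simp: indicator_def)
    also have "\<dots> = (\<integral>\<^sup>+p. ennreal (norm (H p)) \<partial>lborel)"
      unfolding nT by (simp add: nn_integral_cmult_indicator)
    also have "\<dots> < \<infinity>" using H by (simp add: integrable_iff_bounded)
    finally show "(\<integral>\<^sup>+x. ennreal (norm (case x of (\<theta>, p) \<Rightarrow> ?G \<theta> p)) \<partial>(lborel \<Otimes>\<^sub>M lborel)) < \<infinity>" .
  qed
  have eq: "(LINT \<theta>|lborel. ?G \<theta> p) = H0 p" for p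
    using H0[of "fst p" "snd p"] by (simp add: T_def set_lebesgue_integral_def)
  show "integrable lborel H0"
    using lborel_pair.integrable_snd[OF G] by (simp add: eq)
  have "(LINT p|lborel. H0 p) = (LINT \<theta>|lborel. LINT p|lborel. ?G \<theta> p)"
    using lborel_pair.Fubini_integral[OF G] by (simp add: eq)
  also have "\<dots> = (LINT \<theta>:{0..1::real}|lborel. LINT p|lborel. H p)"
    by (simp add: iT set_lebesgue_integral_def)
  also have "\<dots> = (LINT p|lborel. H p)"
    unfolding set_lebesgue_integral_def by (subst integral_scaleR_left) auto
  finally show "(LINT p|lborel. H0 p) = (LINT p|lborel. H p)" .
qed

text \<open>The mean value property is used for the square of \<open>f\<close>, so the norm enters
  the integral without Cauchy-Schwarz. Averaging over rotations then assembles the circles into the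
  disc.\<close>

lemma norm_square_submean_disc:
  assumes hol: "f holomorphic_on S" and S: "open S" "cball z r \<subseteq> S" and r: "r > 0"
  shows "ennreal ((cmod (f z))\<^sup>2) * ennreal (pi * r\<^sup>2) \<le> (\<integral>\<^sup>+u\<in>ball z r. ennreal ((cmod (f u))\<^sup>2) \<partial>lborel)"
proof -
  define H where "H u = ennreal ((cmod (f u))\<^sup>2) * indicator (ball z r) u" for u
  have contf: "continuous_on (ball z r) f"
    by (rule continuous_on_subset[OF holomorphic_on_imp_continuous_on[OF hol]]) (use S in auto)
  have Heq: "H u = ennreal (indicator (ball z r) u *\<^sub>R (cmod (f u))\<^sup>2)" for u
    by (auto simp: H_def indicator_def)
  have [measurable]: "H \<in> borel_measurable borel"
    unfolding Heq[abs_def] 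
    by (intro measurable_compose[OF _ measurable_ennreal] borel_measurable_continuous_on_indicator continuous_intros contf) auto
  have avg: "ennreal ((cmod (f z))\<^sup>2) * indicator (ball 0 r) u \<le> (\<integral>\<^sup>+\<theta>\<in>{0..1}. H (z + cis (2 * pi * \<theta>) * u) \<partial>lborel)" for u
  proof (cases "u \<in> ball 0 r")
    case True
    let ?g = "\<lambda>u. (f (z + u))\<^sup>2"
    have g: "?g holomorphic_on ((+) (- z) ` S)"
      by (intro holomorphic_intros holomorphic_on_compose_gen[OF _ hol, unfolded comp_def]) auto
    have S': "open ((+) (- z) ` S)" "cball 0 r \<subseteq> ((+) (- z) ` S)"
      using S by (auto simp: open_translation_subtract image_iff dist_norm subset_eq intro!: exI[of _ "z + _"] bexI[of _ "z + _"])
    note mean = holomorphic_circle_mean[OF g S', of u]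
    have "ennreal ((cmod (f z))\<^sup>2) = ennreal (norm (LINT \<theta>:{0..1}|lborel. ?g (cis (2 * pi * \<theta>) * u)))"
      using mean(2) True by (simp add: norm_power)
    also have "\<dots> \<le> (\<integral>\<^sup>+\<theta>. ennreal (norm (indicator {0..1} \<theta> *\<^sub>R ?g (cis (2 * pi * \<theta>) * u))) \<partial>lborel)"
      using mean(1) True unfolding set_lebesgue_integral_def set_integrable_def
      by (intro integral_norm_bound_ennreal) auto
    also have "\<dots> = (\<integral>\<^sup>+\<theta>\<in>{0..1}. H (z + cis (2 * pi * \<theta>) * u) \<partial>lborel)"
      using True by (intro nn_integral_cong) (auto simp: H_def indicator_def norm_power dist_norm norm_mult)
    finally show ?thesis using True by simp
  qed auto
  have "ennreal ((cmod (f z))\<^sup>2) * ennreal (pi * r\<^sup>2) = (\<integral>\<^sup>+u. ennreal ((cmod (f z))\<^sup>2) * indicator (ball 0 r) u \<partial>(lborel::complex measure))"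
    using r by (subst nn_integral_cmult_indicator) (auto simp: emeasure_ball unit_ball_vol_2)
  also have "\<dots> \<le> (\<integral>\<^sup>+u. (\<integral>\<^sup>+\<theta>\<in>{0..1}. H (z + cis (2 * pi * \<theta>) * u) \<partial>lborel) \<partial>lborel)"
    by (intro nn_integral_mono avg)
  also have "\<dots> = (\<integral>\<^sup>+u. H (z + u) \<partial>lborel)"
    by (rule nn_integral_rotation_average[symmetric]) measurable
  also have "\<dots> = (\<integral>\<^sup>+u. H u \<partial>lborel)" by (rule nn_integral_lborel_translate) measurable
  finally show ?thesis by (simp add: H_def)
qed

section \<open>Holomorphy in two variables\<close>

lemma holomorphic_on2_compose:
  assumes F: "holomorphic_on2 F D" and S: "open S"
    and g: "g1 holomorphic_on S" "g2 holomorphic_on S" and sub: "\<And>u. u \<in> S \<Longrightarrow> (g1 u, g2 u) \<in> D"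
  shows "(\<lambda>u. F (g1 u, g2 u)) holomorphic_on S"
proof (rule holomorphic_onI)
  fix u assume u: "u \<in> S"
  obtain a b where ab: "(F has_derivative (\<lambda>(h1, h2). a * h1 + b * h2)) (at (g1 u, g2 u))"
    using F sub[OF u] unfolding holomorphic_on2_def by blast
  have d: "(g1 has_derivative (\<lambda>h. deriv g1 u * h)) (at u)" "(g2 has_derivative (\<lambda>h. deriv g2 u * h)) (at u)"
    using holomorphic_derivI[OF g(1) S u] holomorphic_derivI[OF g(2) S u]
    by (auto simp: has_field_derivative_def)
  have "((\<lambda>u. F (g1 u, g2 u)) has_derivative (\<lambda>h. (case (deriv g1 u * h, deriv g2 u * h) of (h1, h2) \<Rightarrow> a * h1 + b * h2))) (at u)"
    by (rule has_derivative_compose[OF has_derivative_Pair[OF d] ab])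
  moreover have "(\<lambda>h. (case (deriv g1 u * h, deriv g2 u * h) of (h1, h2) \<Rightarrow> a * h1 + b * h2)) = (*) (a * deriv g1 u + b * deriv g2 u)"
    by (auto simp: algebra_simps)
  ultimately show "(\<lambda>u. F (g1 u, g2 u)) field_differentiable at u within S"
    unfolding field_differentiable_def has_field_derivative_def
    by (metis has_derivative_at_withinI)
qed

lemma holomorphic_on2_continuous_on:
  assumes "holomorphic_on2 F D"
  shows "continuous_on D F"
  using assms unfolding holomorphic_on2_def
  by (intro continuous_at_imp_continuous_on ballI) (meson has_derivative_continuous)

lemma holomorphic_on2_add_cmult:
  assumes "holomorphic_on2 F D" "holomorphic_on2 G D"
  shows "holomorphic_on2 (\<lambda>p. F p + c * G p) D"
  unfolding holomorphic_on2_def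
proof
  fix p assume p: "p \<in> D"
  obtain a b a' b' where d: "(F has_derivative (\<lambda>(h1, h2). a * h1 + b * h2)) (at p)"
     "(G has_derivative (\<lambda>(h1, h2). a' * h1 + b' * h2)) (at p)"
    using assms p unfolding holomorphic_on2_def by meson
  have "((\<lambda>p. F p + c * G p) has_derivative (\<lambda>x. (case x of (h1, h2) \<Rightarrow> a * h1 + b * h2) + c * (case x of (h1, h2) \<Rightarrow> a' * h1 + b' * h2))) (at p)"
    by (intro has_derivative_add d has_derivative_mult_right)
  moreover have "(\<lambda>x. (case x of (h1, h2) \<Rightarrow> a * h1 + b * h2) + c * (case x of (h1, h2) \<Rightarrow> a' * h1 + b' * h2))
     = (\<lambda>(h1, h2). (a + c * a') * h1 + (b + c * b') * h2)"
    by (auto simp: algebra_simps)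
  ultimately show "\<exists>a b. ((\<lambda>p. F p + c * G p) has_derivative (\<lambda>(h1, h2). a * h1 + b * h2)) (at p)"
    by metis
qed

section \<open>The domain and its boundary surface\<close>

lemma open_quad_domain: "open (quad_domain \<kappa> l)"
  unfolding quad_domain_def quad_phase_def case_prod_beta'
  by (intro open_Collect_less continuous_intros)

lemma frontier_quad_domain: "frontier (quad_domain \<kappa> l) = quad_surface \<kappa> l"
proof -
  have cl: "closure (quad_domain \<kappa> l) = {p. Im (snd p) \<ge> quad_phase \<kappa> l (fst p)}" (is "_ = ?R")
  proof
    have "closed ?R" unfolding quad_phase_def by (intro closed_Collect_le continuous_intros)
    then show "closure (quad_domain \<kappa> l) \<subseteq> ?R"
      by (intro closure_minimal) (auto simp: quad_domain_def)
    show "?R \<subseteq> closure (quad_domain \<kappa> l)"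
    proof
      fix p assume p: "p \<in> ?R"
      have "(\<lambda>n. (fst p, snd p + \<i> * of_real (1 / real (Suc n)))) \<longlonglongrightarrow> (fst p, snd p + \<i> * of_real 0)"
        by (intro tendsto_intros LIMSEQ_Suc lim_1_over_n)
      moreover have "(fst p, snd p + \<i> * of_real (1 / real (Suc n))) \<in> quad_domain \<kappa> l" for n
      proof -
        have "1 / real (Suc n) > 0" by simp
        moreover have "quad_phase \<kappa> l (fst p) \<le> Im (snd p)" using p by simp
        ultimately have "quad_phase \<kappa> l (fst p) < Im (snd p) + 1 / real (Suc n)" by linarith
        then show ?thesis by (simp add: quad_domain_def)
      qed
      ultimately show "p \<in> closure (quad_domain \<kappa> l)"
        unfolding closure_sequential by (intro exI[of _ "\<lambda>n. (fst p, snd p + \<i> * of_real (1 / real (Suc n)))"]) auto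
    qed
  qed
  show ?thesis
    unfolding frontier_def cl interior_open[OF open_quad_domain]
    by (auto simp: quad_domain_def quad_surface_def)
qed

section \<open>Level integrals and the Hardy norm\<close>

text \<open>One member of the family whose supremum is the squared norm. In contrast to the
  supremum, it is a squared L2 norm, hence additive enough for polarization.\<close>

definition hardy_level :: "real \<Rightarrow> complex \<Rightarrow> (complex \<times> complex \<Rightarrow> complex) \<Rightarrow> real \<Rightarrow> ennreal" where
  "hardy_level \<kappa> l F \<epsilon> = (\<integral>\<^sup>+ z'. (\<integral>\<^sup>+ t.
        ennreal ((cmod (F (z', complex_of_real t + \<i> * complex_of_real (quad_phase \<kappa> l z' + \<epsilon>))))\<^sup>2)
          \<partial>lborel) \<partial>lborel)"

lemma hardy_norm_sq_eq_SUP_level: "hardy_norm_sq \<kappa> l F = (SUP \<epsilon>\<in>{0<..}. hardy_level \<kappa> l F \<epsilon>)"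
  by (simp add: hardy_norm_sq_def hardy_level_def)

lemma hardy_level_le_norm: "\<epsilon> > 0 \<Longrightarrow> hardy_level \<kappa> l F \<epsilon> \<le> hardy_norm_sq \<kappa> l F"
  unfolding hardy_norm_sq_eq_SUP_level by (rule SUP_upper) simp

text \<open>Parametrizes a level by one point of the product space, so that Tonelli, Fubini and
  polarization can be applied to a single integral.\<close>

definition level_point :: "real \<Rightarrow> complex \<Rightarrow> real \<Rightarrow> complex \<times> real \<Rightarrow> complex \<times> complex" where
  "level_point \<kappa> l \<epsilon> p = (fst p, complex_of_real (snd p) + \<i> * complex_of_real (quad_phase \<kappa> l (fst p) + \<epsilon>))"

lemma level_point_in_quad_domain: "\<epsilon> > 0 \<Longrightarrow> level_point \<kappa> l \<epsilon> p \<in> quad_domain \<kappa> l"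
  by (simp add: quad_domain_def level_point_def)

lemma measurable_level:
  assumes F: "holomorphic_on2 F (quad_domain \<kappa> l)" and e: "\<epsilon> > 0"
  shows "(\<lambda>p. F (level_point \<kappa> l \<epsilon> p)) \<in> borel_measurable (lborel \<Otimes>\<^sub>M lborel)"
proof -
  have "continuous_on UNIV (level_point \<kappa> l \<epsilon>)"
    unfolding level_point_def quad_phase_def by (intro continuous_intros)
  then have "continuous_on UNIV (\<lambda>p. F (level_point \<kappa> l \<epsilon> p))"
    by (rule continuous_on_compose2[OF holomorphic_on2_continuous_on[OF F]])
      (use e level_point_in_quad_domain in auto)
  then show ?thesis
    unfolding lborel_prod by (auto intro: borel_measurable_continuous_onI)
qed

lemma hardy_level_eq_nn_integral_prod:
  assumes F: "holomorphic_on2 F (quad_domain \<kappa> l)" and e: "\<epsilon> > 0"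
  shows "hardy_level \<kappa> l F \<epsilon> = (\<integral>\<^sup>+p. ennreal ((cmod (F (level_point \<kappa> l \<epsilon> p)))\<^sup>2) \<partial>(lborel \<Otimes>\<^sub>M lborel))"
  unfolding hardy_level_def
proof -
  note [measurable] = measurable_level[OF assms]
  have m: "(\<lambda>p. ennreal ((cmod (F (level_point \<kappa> l \<epsilon> p)))\<^sup>2)) \<in> borel_measurable (lborel \<Otimes>\<^sub>M lborel)"
    by measurable
  show "(\<integral>\<^sup>+ z'. (\<integral>\<^sup>+ t.
        ennreal ((cmod (F (z', complex_of_real t + \<i> * complex_of_real (quad_phase \<kappa> l z' + \<epsilon>))))\<^sup>2)
          \<partial>lborel) \<partial>lborel) = (\<integral>\<^sup>+p. ennreal ((cmod (F (level_point \<kappa> l \<epsilon> p)))\<^sup>2) \<partial>(lborel \<Otimes>\<^sub>M lborel))"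
    using lborel.nn_integral_fst[OF m] by (simp add: level_point_def)
qed

section \<open>Pointwise bounds from the Hardy norm\<close>

text \<open>|F|^2 is submean in each variable, so its value at the centre is controlled by the
  integral over the bidisc of radii \<open>r\<close> and \<open>R\<close>; the hypothesis on
  \<open>Im z\<close> places the closed bidisc in the domain. Slicing that integral by levels bounds
  it by the length of the range of levels times the norm.\<close>

lemma hardy_bidisc_bound:
  assumes k: "\<kappa> > 0" and F: "holomorphic_on2 F (quad_domain \<kappa> 0)"
    and r: "r > 0" "R > 0" and z: "Im z > \<kappa> * (cmod \<zeta> + r)\<^sup>2 + R"
  shows "ennreal ((cmod (F (\<zeta>, z)))\<^sup>2) * ennreal (pi * r\<^sup>2) * ennreal (pi * R\<^sup>2)
     \<le> ennreal (Im z + R) * hardy_norm_sq \<kappa> 0 F"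
proof -
  define D where "D = quad_domain \<kappa> 0"
  have D: "(u, s) \<in> D \<longleftrightarrow> Im s > \<kappa> * (cmod u)\<^sup>2" for u s
    by (simp add: D_def quad_domain_def quad_phase_def)
  have oD: "open D" unfolding D_def by (rule open_quad_domain)
  \<comment> \<open>Extension by zero gives a function that is measurable on the whole space, so
    integrals can be exchanged and translated without tracking the domain.\<close>
  define \<Phi> where "\<Phi> p = ennreal ((cmod (F p))\<^sup>2) * indicator D p" for p
  have \<Phi>eq: "\<Phi> p = ennreal (indicator D p *\<^sub>R (cmod (F p))\<^sup>2)" for p
    by (auto simp: \<Phi>_def indicator_def)
  have [measurable]: "\<Phi> \<in> borel_measurable borel"
    unfolding \<Phi>eq[abs_def] using holomorphic_on2_continuous_on[OF F] oD
    by (intro measurable_compose[OF _ measurable_ennreal] borel_measurable_continuous_on_indicator continuous_intros)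
      (auto simp: D_def)
  have mPair[measurable]: "(\<lambda>p. \<Phi> (f p, g p)) \<in> borel_measurable M" if [measurable]: "f \<in> borel_measurable M" "g \<in> borel_measurable M" for f g and M :: "'b measure"
    by (rule measurable_compose[of "\<lambda>p. (f p, g p)" M borel]) (use that in \<open>auto intro: borel_measurable_Pair\<close>)
  have mC[measurable]: "(\<lambda>p. Complex (f p) (g p)) \<in> borel_measurable M" if [measurable]: "f \<in> borel_measurable M" "g \<in> borel_measurable M" for f g and M :: "'b measure"
    unfolding Complex_eq by measurable
  have small: "\<kappa> * (cmod u)\<^sup>2 \<le> \<kappa> * (cmod \<zeta> + r)\<^sup>2" if "u \<in> cball \<zeta> r" for u
  proof -
    have "cmod u \<le> cmod \<zeta> + r" using that norm_triangle_ineq2[of u \<zeta>] by (auto simp: dist_norm norm_minus_commute)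
    then show ?thesis using k by (intro mult_left_mono power_mono) auto
  qed
  have step1: "ennreal ((cmod (F (\<zeta>, z)))\<^sup>2) * ennreal (pi * r\<^sup>2) \<le> (\<integral>\<^sup>+u\<in>ball \<zeta> r. \<Phi> (u, z) \<partial>lborel)"
  proof -
    let ?S = "{u. \<kappa> * (cmod u)\<^sup>2 < Im z}"
    have S: "open ?S" "cball \<zeta> r \<subseteq> ?S"
      using small z r by (force intro!: open_Collect_less continuous_intros)+
    have "(\<lambda>u. F (u, z)) holomorphic_on ?S"
      by (rule holomorphic_on2_compose[OF F S(1)]) (auto simp: D D_def[symmetric])
    from norm_square_submean_disc[OF this S r(1)]
    have "ennreal ((cmod (F (\<zeta>, z)))\<^sup>2) * ennreal (pi * r\<^sup>2) \<le> (\<integral>\<^sup>+u\<in>ball \<zeta> r. ennreal ((cmod (F (u, z)))\<^sup>2) \<partial>lborel)" .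
    also have "\<dots> = (\<integral>\<^sup>+u\<in>ball \<zeta> r. \<Phi> (u, z) \<partial>lborel)"
      using S(2) by (intro nn_integral_cong) (auto simp: \<Phi>_def indicator_def D subset_eq)
    finally show ?thesis .
  qed
  let ?E = "\<lambda>u \<epsilon>. (\<integral>\<^sup>+x. \<Phi> (u, of_real x + \<i> * of_real (\<kappa> * (cmod u)\<^sup>2 + \<epsilon>)) \<partial>lborel)"
  \<comment> \<open>Above \<open>u\<close>, the height \<open>y\<close> belongs to the level \<open>\<epsilon> = y - \<kappa> |u|\<^sup>2\<close>, which lies between \<open>0\<close> and \<open>Im z + R\<close>.\<close>
  have step2: "\<Phi> (u, z) * ennreal (pi * R\<^sup>2) \<le> (\<integral>\<^sup>+\<epsilon>\<in>{0<..<Im z + R}. ?E u \<epsilon> \<partial>lborel)" if u: "u \<in> ball \<zeta> r" for u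
  proof -
    let ?S = "{s. \<kappa> * (cmod u)\<^sup>2 < Im s}"
    let ?I = "{Im z - R <..< Im z + R}"
    have up: "\<kappa> * (cmod u)\<^sup>2 < Im z - R" using small[of u] u z by auto
    have abs: "\<bar>Im s - Im z\<bar> \<le> cmod (z - s)" for s
      using abs_Im_le_cmod[of "s - z"] by (simp add: norm_minus_commute)
    have S: "open ?S" "cball z R \<subseteq> ?S"
      subgoal by (intro open_Collect_less continuous_intros)
      subgoal
      proof
        fix s assume "s \<in> cball z R"
        then have "\<bar>Im s - Im z\<bar> \<le> R" using abs[of s] by (simp add: dist_norm)
        then show "s \<in> ?S" using up by auto
      qed
      done
    have "(\<lambda>s. F (u, s)) holomorphic_on ?S"
      by (rule holomorphic_on2_compose[OF F S(1)]) (auto simp: D D_def[symmetric])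
    from norm_square_submean_disc[OF this S r(2)]
    have "ennreal ((cmod (F (u, z)))\<^sup>2) * ennreal (pi * R\<^sup>2) \<le> (\<integral>\<^sup>+s\<in>ball z R. ennreal ((cmod (F (u, s)))\<^sup>2) \<partial>lborel)" .
    also have "\<dots> \<le> (\<integral>\<^sup>+s. \<Phi> (u, s) * indicator ?I (Im s) \<partial>lborel)"
    proof (intro nn_integral_mono)
      fix s
      show "ennreal ((cmod (F (u, s)))\<^sup>2) * indicator (ball z R) s \<le> \<Phi> (u, s) * indicator ?I (Im s)"
      proof (cases "s \<in> ball z R")
        case True
        then have "s \<in> ?S" "Im s \<in> ?I" using S(2) abs[of s] by (auto simp: dist_norm subset_eq)
        then show ?thesis using True by (auto simp: \<Phi>_def D)
      qed auto
    qed
    also have "\<dots> = (\<integral>\<^sup>+y. \<integral>\<^sup>+x. \<Phi> (u, Complex x y) * indicator ?I y \<partial>lborel \<partial>lborel)"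
      by (subst nn_integral_lborel_complex) simp_all
    also have "\<dots> = (\<integral>\<^sup>+\<epsilon>. \<integral>\<^sup>+x. \<Phi> (u, Complex x (\<kappa> * (cmod u)\<^sup>2 + \<epsilon>)) * indicator ?I (\<kappa> * (cmod u)\<^sup>2 + \<epsilon>) \<partial>lborel \<partial>lborel)"
      by (rule nn_integral_lborel_translate[symmetric]) measurable
    also have "\<dots> \<le> (\<integral>\<^sup>+\<epsilon>\<in>{0<..<Im z + R}. ?E u \<epsilon> \<partial>lborel)"
    proof (intro nn_integral_mono)
      fix \<epsilon>
      have "0 \<le> \<kappa> * (cmod u)\<^sup>2" using k by simp
      then have "\<epsilon> \<in> {0<..<Im z + R}" if "\<kappa> * (cmod u)\<^sup>2 + \<epsilon> \<in> ?I"
        using that up by auto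
      then show "(\<integral>\<^sup>+x. \<Phi> (u, Complex x (\<kappa> * (cmod u)\<^sup>2 + \<epsilon>)) * indicator ?I (\<kappa> * (cmod u)\<^sup>2 + \<epsilon>) \<partial>lborel) \<le> ?E u \<epsilon> * indicator {0<..<Im z + R} \<epsilon>"
        by (cases "\<kappa> * (cmod u)\<^sup>2 + \<epsilon> \<in> ?I") (auto simp: Complex_eq)
    qed
    finally show ?thesis using up r by (simp add: \<Phi>_def D)
  qed
  have "ennreal ((cmod (F (\<zeta>, z)))\<^sup>2) * ennreal (pi * r\<^sup>2) * ennreal (pi * R\<^sup>2) \<le> (\<integral>\<^sup>+u\<in>ball \<zeta> r. \<Phi> (u, z) \<partial>lborel) * ennreal (pi * R\<^sup>2)"
    by (intro mult_right_mono step1) auto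
  also have "\<dots> = (\<integral>\<^sup>+u\<in>ball \<zeta> r. (\<Phi> (u, z) * ennreal (pi * R\<^sup>2)) \<partial>lborel)"
  proof -
    have [measurable]: "ball \<zeta> r \<in> sets borel" by simp
    have "(\<lambda>u. g u * indicator (ball \<zeta> r) u) \<in> borel_measurable borel"
      if [measurable]: "g \<in> borel_measurable borel" for g :: "complex \<Rightarrow> ennreal" by measurable
    from this[OF mPair] have "(\<lambda>u. \<Phi> (u, z) * indicator (ball \<zeta> r) u) \<in> borel_measurable borel" by simp
    then show ?thesis by (subst nn_integral_multc[symmetric]) (simp_all add: mult_ac)
  qed
  also have "\<dots> \<le> (\<integral>\<^sup>+u. (\<integral>\<^sup>+\<epsilon>\<in>{0<..<Im z + R}. ?E u \<epsilon> \<partial>lborel) \<partial>lborel)"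
    using step2 by (intro nn_integral_mono) (auto simp: indicator_def)
  also have "\<dots> = (\<integral>\<^sup>+\<epsilon>. (\<integral>\<^sup>+u. ?E u \<epsilon> * indicator {0<..<Im z + R} \<epsilon> \<partial>lborel) \<partial>lborel)"
    by (rule lborel_pair.Fubini') measurable
  also have "\<dots> \<le> (\<integral>\<^sup>+\<epsilon>. hardy_norm_sq \<kappa> 0 F * indicator {0<..<Im z + R} \<epsilon> \<partial>lborel)"
  proof (intro nn_integral_mono)
    fix \<epsilon>
    show "(\<integral>\<^sup>+u. ?E u \<epsilon> * indicator {0<..<Im z + R} \<epsilon> \<partial>lborel) \<le> hardy_norm_sq \<kappa> 0 F * indicator {0<..<Im z + R} \<epsilon>"
    proof (cases "\<epsilon> \<in> {0<..<Im z + R}")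
      case True
      then have "(\<integral>\<^sup>+u. ?E u \<epsilon> * indicator {0<..<Im z + R} \<epsilon> \<partial>lborel) = hardy_level \<kappa> 0 F \<epsilon>"
        unfolding hardy_level_def by (auto intro!: nn_integral_cong simp: \<Phi>_def D quad_phase_def)
      then show ?thesis using hardy_level_le_norm[of \<epsilon> \<kappa> 0 F] True by simp
    qed auto
  qed
  also have "\<dots> = ennreal (Im z + R) * hardy_norm_sq \<kappa> 0 F"
  proof -
    have "0 \<le> \<kappa> * (cmod \<zeta> + r)\<^sup>2" using k by simp
    then show ?thesis using z r by (subst nn_integral_cmult_indicator) (auto simp: mult.commute)
  qed
  finally show ?thesis .
qed

lemma hardy_bidisc_bound_real:
  assumes k: "\<kappa> > 0" and F: "F \<in> hardy_space \<kappa> 0"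
    and r: "r > 0" "R > 0" and z: "Im z > \<kappa> * (cmod \<zeta> + r)\<^sup>2 + R"
  shows "(cmod (F (\<zeta>, z)))\<^sup>2 \<le> enn2real (hardy_norm_sq \<kappa> 0 F) / (pi\<^sup>2 * r\<^sup>2) * ((Im z + R) / R\<^sup>2)"
proof -
  have F': "holomorphic_on2 F (quad_domain \<kappa> 0)" "hardy_norm_sq \<kappa> 0 F < \<infinity>"
    using F by (auto simp: hardy_space_def)
  have N: "hardy_norm_sq \<kappa> 0 F = ennreal (enn2real (hardy_norm_sq \<kappa> 0 F))" using F' by simp
  have "0 \<le> \<kappa> * (cmod \<zeta> + r)\<^sup>2" using k by simp
  then have p: "Im z + R > 0" using z r by linarith
  have "ennreal ((cmod (F (\<zeta>, z)))\<^sup>2 * (pi * r\<^sup>2) * (pi * R\<^sup>2)) \<le> ennreal ((Im z + R) * enn2real (hardy_norm_sq \<kappa> 0 F))"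
    using hardy_bidisc_bound[OF k F'(1) r z] p by (subst (asm) N) (simp add: ennreal_mult)
  then have "(cmod (F (\<zeta>, z)))\<^sup>2 * (pi * r\<^sup>2) * (pi * R\<^sup>2) \<le> (Im z + R) * enn2real (hardy_norm_sq \<kappa> 0 F)"
    using p by (subst (asm) ennreal_le_iff) auto
  then show ?thesis using r by (simp add: field_simps power2_eq_square)
qed

text \<open>The radius \<open>r\<close> is fixed so small that the disc around \<zeta> costs at most
  half of the margin \<epsilon>; the radius in the second variable grows with the height.\<close>

lemma hardy_slice_bounded:
  assumes k: "\<kappa> > 0" and F: "F \<in> hardy_space \<kappa> 0" and e: "\<epsilon> > 0"
  shows "\<exists>M. \<forall>z. Im z \<ge> \<kappa> * (cmod \<zeta>)\<^sup>2 + \<epsilon> \<longrightarrow> cmod (F (\<zeta>, z)) \<le> M"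
proof -
  define a where "a = \<kappa> * (cmod \<zeta>)\<^sup>2"
  have a: "a \<ge> 0" using k by (simp add: a_def)
  have "((\<lambda>r. \<kappa> * (cmod \<zeta> + r)\<^sup>2) \<longlongrightarrow> \<kappa> * (cmod \<zeta> + 0)\<^sup>2) (at_right 0)"
    by (intro tendsto_intros)
  then have "\<forall>\<^sub>F r in at_right 0. \<kappa> * (cmod \<zeta> + r)\<^sup>2 < a + \<epsilon> / 2"
    using e by (intro order_tendstoD) (auto simp: a_def)
  then have "\<forall>\<^sub>F r in at_right 0. \<kappa> * (cmod \<zeta> + r)\<^sup>2 < a + \<epsilon> / 2 \<and> r > 0"
    by (intro eventually_conj eventually_at_right_less)
  then obtain r where r: "r > 0" "\<kappa> * (cmod \<zeta> + r)\<^sup>2 < a + \<epsilon> / 2"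
    by (auto dest!: eventually_happens simp: trivial_limit_at_right_real)
  define N where "N = enn2real (hardy_norm_sq \<kappa> 0 F) / (pi\<^sup>2 * r\<^sup>2)"
  have N: "N \<ge> 0" by (simp add: N_def)
  have "cmod (F (\<zeta>, z)) \<le> sqrt (N * (4 * a / \<epsilon>\<^sup>2 + 6 / \<epsilon>))" if z: "Im z \<ge> a + \<epsilon>" for z
  proof -
    \<comment> \<open>The second radius will be \<open>h / 2\<close>. A constant radius would leave
      a bound that is linear in \<open>Im z\<close>; with this one the factor is 4a/h^2 + 6/h, which
      decreases in \<open>h\<close>.\<close>
    define h where "h = Im z - a"
    have h: "h \<ge> \<epsilon>" "h > 0" using z e by (auto simp: h_def)
    have "(cmod (F (\<zeta>, z)))\<^sup>2 \<le> N * ((Im z + h / 2) / (h / 2)\<^sup>2)"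
    proof -
      have "Im z > X + h / 2" if "X < a + \<epsilon> / 2" for X using that h(1) by (simp add: h_def field_simps)
      from this[OF r(2)] have "Im z > \<kappa> * (cmod \<zeta> + r)\<^sup>2 + h / 2" .
      then show ?thesis unfolding N_def using h r by (intro hardy_bidisc_bound_real[OF k F]) auto
    qed
    also have "(Im z + h / 2) / (h / 2)\<^sup>2 = 4 * a / h\<^sup>2 + 6 / h"
      using h by (simp add: h_def[symmetric] divide_simps) (simp add: h_def power2_eq_square algebra_simps)
    also have "N * \<dots> \<le> N * (4 * a / \<epsilon>\<^sup>2 + 6 / \<epsilon>)"
      using h e a N by (intro mult_left_mono add_mono frac_le power_mono) auto
    finally show ?thesis by (rule real_le_rsqrt)
  qed
  then show ?thesis unfolding a_def by blast
qed

text \<open>Supplies the vanishing term at infinity when the radial integral telescopes. With first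
  radius 1 and second radius half the height, the bidisc bound decays like the reciprocal of the
  height; the bidisc fits as soon as the height exceeds 2\<kappa>.\<close>

lemma hardy_slice_tendsto_0:
  assumes k: "\<kappa> > 0" and F: "F \<in> hardy_space \<kappa> 0"
  shows "((\<lambda>u. F (0, w + \<i> * of_real u)) \<longlongrightarrow> 0) at_top"
proof -
  define N where "N = enn2real (hardy_norm_sq \<kappa> 0 F) / pi\<^sup>2"
  have "((\<lambda>u. (cmod (F (0, w + \<i> * of_real u)))\<^sup>2) \<longlongrightarrow> 0) at_top"
  proof (rule Lim_null_comparison)
    have "\<forall>\<^sub>F u in at_top. Im w + u > 2 * \<kappa>" by real_asymp
    then show "\<forall>\<^sub>F u in at_top. norm ((cmod (F (0, w + \<i> * of_real u)))\<^sup>2) \<le> N * (((Im w + u) + (Im w + u) / 2) / ((Im w + u) / 2)\<^sup>2)"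
    proof eventually_elim
      case (elim u)
      then have "\<kappa> + (Im w + u) / 2 < Im w + u" "0 < Im w + u" using k by (simp_all add: field_simps)
      then show ?case
        using hardy_bidisc_bound_real[OF k F, of 1 "(Im w + u) / 2" 0 "w + \<i> * of_real u"] k by (simp add: N_def)
    qed
    show "((\<lambda>u. N * (((Im w + u) + (Im w + u) / 2) / ((Im w + u) / 2)\<^sup>2)) \<longlongrightarrow> 0) at_top"
      by real_asymp
  qed
  then have "((\<lambda>u. sqrt ((cmod (F (0, w + \<i> * of_real u)))\<^sup>2)) \<longlongrightarrow> sqrt 0) at_top"
    by (rule tendsto_real_sqrt)
  then show ?thesis by (simp add: tendsto_norm_zero_iff)
qed

lemma hardy_slice_holomorphic:
  assumes F: "holomorphic_on2 F (quad_domain \<kappa> 0)"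
  shows "(\<lambda>z. F (\<zeta>, z + \<i> * of_real (\<kappa> * (cmod \<zeta>)\<^sup>2 + \<epsilon>))) holomorphic_on {z. Im z > - \<epsilon>}"
  by (rule holomorphic_on2_compose[OF F])
    (auto intro!: holomorphic_intros simp: open_halfspace_Im_gt quad_domain_def quad_phase_def)

section \<open>The norm as a limit of level integrals\<close>

text \<open>Over a fixed \<zeta>, passing from level \<epsilon> to level \<delta> is a vertical
  shift by \<delta> - \<epsilon>, so the half plane estimate applies slice by slice. Slices are
  bounded only away from the boundary, hence the half plane reaches down to level
  \<epsilon>/2.\<close>

lemma hardy_level_decreasing:
  assumes k: "\<kappa> > 0" and F: "F \<in> hardy_space \<kappa> 0" and e: "0 < \<epsilon>" "\<epsilon> < \<delta>"
  shows "hardy_level \<kappa> 0 F \<delta> \<le> hardy_level \<kappa> 0 F \<epsilon>"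
  unfolding hardy_level_def
proof (rule nn_integral_mono)
  fix \<zeta> :: complex
  have F': "holomorphic_on2 F (quad_domain \<kappa> 0)" using F by (simp add: hardy_space_def)
  let ?f = "\<lambda>z. F (\<zeta>, z + \<i> * of_real (\<kappa> * (cmod \<zeta>)\<^sup>2 + \<epsilon>))"
  obtain M where M: "\<forall>z. Im z \<ge> \<kappa> * (cmod \<zeta>)\<^sup>2 + \<epsilon> / 2 \<longrightarrow> cmod (F (\<zeta>, z)) \<le> M"
    using hardy_slice_bounded[OF k F, of "\<epsilon> / 2" \<zeta>] e by auto
  have "?f holomorphic_on {z. Im z > - (\<epsilon> / 2)}"
    by (rule holomorphic_on_subset[OF hardy_slice_holomorphic[OF F']]) (use e in auto)
  moreover have "\<forall>z. Im z > - (\<epsilon> / 2) \<longrightarrow> cmod (?f z) \<le> M"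
    using M by auto
  ultimately have "(\<integral>\<^sup>+x. ennreal ((cmod (?f (of_real x + \<i> * of_real (\<delta> - \<epsilon>))))\<^sup>2) \<partial>lborel) \<le> (\<integral>\<^sup>+t. ennreal ((cmod (?f (of_real t)))\<^sup>2) \<partial>lborel)"
    using e by (intro half_plane_L2_decreasing) auto
  then show "(\<integral>\<^sup>+ t. ennreal ((cmod (F (\<zeta>, complex_of_real t + \<i> * complex_of_real (quad_phase \<kappa> 0 \<zeta> + \<delta>))))\<^sup>2) \<partial>lborel)
    \<le> (\<integral>\<^sup>+ t. ennreal ((cmod (F (\<zeta>, complex_of_real t + \<i> * complex_of_real (quad_phase \<kappa> 0 \<zeta> + \<epsilon>))))\<^sup>2) \<partial>lborel)"
    by (simp add: quad_phase_def algebra_simps)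
qed

text \<open>The heights do not depend on \<open>F\<close>; this lets the four norms in a polarized
  inner product converge along the same sequence.\<close>

lemma hardy_level_tendsto:
  assumes k: "\<kappa> > 0" and F: "F \<in> hardy_space \<kappa> 0"
  shows "(\<lambda>n. enn2real (hardy_level \<kappa> 0 F (1 / real (Suc n)))) \<longlonglongrightarrow> enn2real (hardy_norm_sq \<kappa> 0 F)"
proof -
  let ?e = "\<lambda>n. 1 / real (Suc n)"
  have "hardy_norm_sq \<kappa> 0 F = (SUP n. hardy_level \<kappa> 0 F (?e n))"
  proof (rule antisym)
    show "(SUP n. hardy_level \<kappa> 0 F (?e n)) \<le> hardy_norm_sq \<kappa> 0 F"
      by (intro SUP_least hardy_level_le_norm) simp
    show "hardy_norm_sq \<kappa> 0 F \<le> (SUP n. hardy_level \<kappa> 0 F (?e n))"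
      unfolding hardy_norm_sq_eq_SUP_level
    proof (rule SUP_least)
      fix \<delta> :: real assume "\<delta> \<in> {0<..}"
      then obtain n where "?e n < \<delta>" using nat_approx_posE[of \<delta>] by auto
      then have "hardy_level \<kappa> 0 F \<delta> \<le> hardy_level \<kappa> 0 F (?e n)"
        by (intro hardy_level_decreasing[OF k F]) auto
      then show "hardy_level \<kappa> 0 F \<delta> \<le> (SUP n. hardy_level \<kappa> 0 F (?e n))"
        by (rule SUP_upper2[rotated]) simp
    qed
  qed
  moreover have "incseq (\<lambda>n. hardy_level \<kappa> 0 F (?e n))"
    by (rule incseq_SucI, rule hardy_level_decreasing[OF k F]) (auto simp: divide_strict_left_mono)
  ultimately have "(\<lambda>n. hardy_level \<kappa> 0 F (?e n)) \<longlonglongrightarrow> hardy_norm_sq \<kappa> 0 F"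
    using LIMSEQ_SUP by metis
  then show ?thesis
    using F by (intro tendsto_enn2real) (auto simp: hardy_space_def)
qed

section \<open>Linear combinations and polarization on a level\<close>

lemma norm_add_square_le: "(cmod (a + b))\<^sup>2 \<le> 2 * (cmod a)\<^sup>2 + 2 * (cmod b)\<^sup>2"
proof -
  have "(cmod (a + b))\<^sup>2 \<le> (cmod a + cmod b)\<^sup>2" by (intro power_mono norm_triangle_ineq) auto
  also have "\<dots> \<le> 2 * (cmod a)\<^sup>2 + 2 * (cmod b)\<^sup>2"
    using sum_squares_bound[of "cmod a" "cmod b"] by (simp add: power2_sum)
  finally show ?thesis .
qed

text \<open>Guarantees that the four norms in the inner product are finite; \<open>enn2real\<close>
  would silently turn an infinite one into 0. The estimate is made level by level with a bound
  independent of \<epsilon>.\<close>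

lemma hardy_space_add_cmult:
  assumes F: "F \<in> hardy_space \<kappa> l" and G: "G \<in> hardy_space \<kappa> l"
  shows "(\<lambda>p. F p + c * G p) \<in> hardy_space \<kappa> l"
proof -
  have F': "holomorphic_on2 F (quad_domain \<kappa> l)" "hardy_norm_sq \<kappa> l F < \<infinity>"
    and G': "holomorphic_on2 G (quad_domain \<kappa> l)" "hardy_norm_sq \<kappa> l G < \<infinity>"
    using F G by (auto simp: hardy_space_def)
  note h = holomorphic_on2_add_cmult[OF F'(1) G'(1), of c]
  have "hardy_level \<kappa> l (\<lambda>p. F p + c * G p) \<epsilon> \<le> 2 * hardy_norm_sq \<kappa> l F + ennreal (2 * (cmod c)\<^sup>2) * hardy_norm_sq \<kappa> l G"
    if e: "\<epsilon> > 0" for \<epsilon>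
  proof -
    note [measurable] = measurable_level[OF F'(1) e] measurable_level[OF G'(1) e]
    have "hardy_level \<kappa> l (\<lambda>p. F p + c * G p) \<epsilon> \<le>
      (\<integral>\<^sup>+p. 2 * ennreal ((cmod (F (level_point \<kappa> l \<epsilon> p)))\<^sup>2)
        + ennreal (2 * (cmod c)\<^sup>2) * ennreal ((cmod (G (level_point \<kappa> l \<epsilon> p)))\<^sup>2) \<partial>(lborel \<Otimes>\<^sub>M lborel))"
      unfolding hardy_level_eq_nn_integral_prod[OF h e]
    proof (intro nn_integral_mono)
      fix p :: "complex \<times> real"
      let ?a = "F (level_point \<kappa> l \<epsilon> p)"
      let ?b = "G (level_point \<kappa> l \<epsilon> p)"
      have "ennreal ((cmod (?a + c * ?b))\<^sup>2) \<le> ennreal (2 * (cmod ?a)\<^sup>2 + 2 * (cmod c)\<^sup>2 * (cmod ?b)\<^sup>2)"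
        using norm_add_square_le[of ?a "c * ?b"] by (intro ennreal_leI) (simp add: norm_mult power_mult_distrib)
      also have "\<dots> = 2 * ennreal ((cmod ?a)\<^sup>2) + ennreal (2 * (cmod c)\<^sup>2) * ennreal ((cmod ?b)\<^sup>2)"
        by (simp add: ennreal_plus ennreal_mult)
      finally show "ennreal ((cmod (?a + c * ?b))\<^sup>2) \<le> 2 * ennreal ((cmod ?a)\<^sup>2) + ennreal (2 * (cmod c)\<^sup>2) * ennreal ((cmod ?b)\<^sup>2)" .
    qed
    also have "\<dots> = 2 * hardy_level \<kappa> l F \<epsilon> + ennreal (2 * (cmod c)\<^sup>2) * hardy_level \<kappa> l G \<epsilon>"
      unfolding hardy_level_eq_nn_integral_prod[OF F'(1) e] hardy_level_eq_nn_integral_prod[OF G'(1) e]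
      by (simp add: nn_integral_add nn_integral_cmult)
    also have "\<dots> \<le> 2 * hardy_norm_sq \<kappa> l F + ennreal (2 * (cmod c)\<^sup>2) * hardy_norm_sq \<kappa> l G"
      by (intro add_mono mult_left_mono hardy_level_le_norm e) auto
    finally show ?thesis .
  qed
  then have "hardy_norm_sq \<kappa> l (\<lambda>p. F p + c * G p) \<le> 2 * hardy_norm_sq \<kappa> l F + ennreal (2 * (cmod c)\<^sup>2) * hardy_norm_sq \<kappa> l G"
    unfolding hardy_norm_sq_eq_SUP_level[of _ _ "\<lambda>p. F p + c * G p"] by (intro SUP_least) auto
  also have "\<dots> < \<infinity>" using F'(2) G'(2) by (simp add: ennreal_mult_less_top)
  finally show ?thesis using h by (simp add: hardy_space_def)
qed

lemma sum_lessThan_4: "(\<Sum>k<4. f k) = f 0 + f 1 + f 2 + f 3" for f :: "nat \<Rightarrow> complex"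
  by (simp add: eval_nat_numeral lessThan_Suc algebra_simps)

lemma imaginary_unit_cubed: "\<i> ^ 3 = - \<i>"
  by (simp add: eval_nat_numeral)

lemma complex_polarization: "(\<Sum>k<4. \<i> ^ k * complex_of_real ((cmod (a + \<i> ^ k * b))\<^sup>2)) / 4 = a * cnj b"
proof -
  show ?thesis
    unfolding sum_lessThan_4 imaginary_unit_cubed cmod_power2 by (simp add: complex_eq_iff power2_eq_square algebra_simps) (simp add: field_simps)
qed

lemma integrable_mult_cnj:
  fixes f g :: "'b \<Rightarrow> complex"
  assumes [measurable]: "f \<in> borel_measurable M" "g \<in> borel_measurable M"
    and f: "integrable M (\<lambda>x. (cmod (f x))\<^sup>2)" and g: "integrable M (\<lambda>x. (cmod (g x))\<^sup>2)"
  shows "integrable M (\<lambda>x. f x * cnj (g x))"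
proof (rule Bochner_Integration.integrable_bound)
  show "integrable M (\<lambda>x. (cmod (f x))\<^sup>2 + (cmod (g x))\<^sup>2)" using f g by auto
  have [measurable]: "cnj \<in> borel_measurable borel"
    by (intro borel_measurable_continuous_onI) (auto intro!: continuous_intros)
  show "(\<lambda>x. f x * cnj (g x)) \<in> borel_measurable M" by measurable
  show "AE x in M. norm (f x * cnj (g x)) \<le> norm ((cmod (f x))\<^sup>2 + (cmod (g x))\<^sup>2)"
  proof (rule AE_I2)
    fix x
    have "2 * (cmod (f x) * cmod (g x)) \<le> (cmod (f x))\<^sup>2 + (cmod (g x))\<^sup>2"
      using sum_squares_bound[of "cmod (f x)" "cmod (g x)"] by simp
    moreover have "cmod (f x) * cmod (g x) \<ge> 0" by simp
    ultimately have "cmod (f x) * cmod (g x) \<le> (cmod (f x))\<^sup>2 + (cmod (g x))\<^sup>2" by linarith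
    then show "norm (f x * cnj (g x)) \<le> norm ((cmod (f x))\<^sup>2 + (cmod (g x))\<^sup>2)"
      by (simp add: norm_mult)
  qed
qed

lemma
  assumes F: "F \<in> hardy_space \<kappa> l" and e: "\<epsilon> > 0"
  shows hardy_level_integrable: "integrable (lborel \<Otimes>\<^sub>M lborel) (\<lambda>p. (cmod (F (level_point \<kappa> l \<epsilon> p)))\<^sup>2)"
    and enn2real_hardy_level: "enn2real (hardy_level \<kappa> l F \<epsilon>) = (LINT p|(lborel \<Otimes>\<^sub>M lborel). (cmod (F (level_point \<kappa> l \<epsilon> p)))\<^sup>2)"
proof -
  have F': "holomorphic_on2 F (quad_domain \<kappa> l)" "hardy_norm_sq \<kappa> l F < \<infinity>"
    using F by (auto simp: hardy_space_def)
  note [measurable] = measurable_level[OF F'(1) e]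
  have "hardy_level \<kappa> l F \<epsilon> < \<infinity>" using hardy_level_le_norm[OF e, of \<kappa> l F] F'(2) by (rule le_less_trans)
  then show i: "integrable (lborel \<Otimes>\<^sub>M lborel) (\<lambda>p. (cmod (F (level_point \<kappa> l \<epsilon> p)))\<^sup>2)"
    unfolding hardy_level_eq_nn_integral_prod[OF F'(1) e] by (intro integrableI_bounded) auto
  show "enn2real (hardy_level \<kappa> l F \<epsilon>) = (LINT p|(lborel \<Otimes>\<^sub>M lborel). (cmod (F (level_point \<kappa> l \<epsilon> p)))\<^sup>2)"
    unfolding hardy_level_eq_nn_integral_prod[OF F'(1) e] by (subst nn_integral_eq_integral[OF i]) auto
qed

text \<open>Here the formal sum of norms becomes an actual pairing: all four norms are integrals
  over the same space, so the scalar polarization identity holds under the integral sign.\<close>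

lemma hardy_level_polarization:
  fixes F G
  assumes F: "F \<in> hardy_space \<kappa> l" and G: "G \<in> hardy_space \<kappa> l" and e: "\<epsilon> > 0"
  defines "A \<equiv> \<lambda>H p. H (level_point \<kappa> l \<epsilon> p)"
  shows "integrable (lborel \<Otimes>\<^sub>M lborel) (\<lambda>p. A F p * cnj (A G p))"
    and "(\<Sum>k<4. \<i> ^ k * complex_of_real (enn2real (hardy_level \<kappa> l (\<lambda>p. F p + \<i> ^ k * G p) \<epsilon>))) / 4 =
      (LINT p|(lborel \<Otimes>\<^sub>M lborel). A F p * cnj (A G p))"
proof -
  have F': "holomorphic_on2 F (quad_domain \<kappa> l)" "holomorphic_on2 G (quad_domain \<kappa> l)"
    using F G by (auto simp: hardy_space_def)
  show "integrable (lborel \<Otimes>\<^sub>M lborel) (\<lambda>p. A F p * cnj (A G p))" unfolding A_def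
    by (intro integrable_mult_cnj hardy_level_integrable F G e measurable_level F')
  have "enn2real (hardy_level \<kappa> l (\<lambda>p. F p + \<i> ^ k * G p) \<epsilon>) = (LINT p|(lborel \<Otimes>\<^sub>M lborel). (cmod (A F p + \<i> ^ k * A G p))\<^sup>2)"
   and i: "integrable (lborel \<Otimes>\<^sub>M lborel) (\<lambda>p. (cmod (A F p + \<i> ^ k * A G p))\<^sup>2)" for k
    using enn2real_hardy_level[OF hardy_space_add_cmult[OF F G] e, of "\<i> ^ k"]
      hardy_level_integrable[OF hardy_space_add_cmult[OF F G] e, of "\<i> ^ k"]
    by (simp_all add: A_def)
  then have "(\<Sum>k<4. \<i> ^ k * complex_of_real (enn2real (hardy_level \<kappa> l (\<lambda>p. F p + \<i> ^ k * G p) \<epsilon>))) / 4 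
    = (\<Sum>k<4. (LINT p|(lborel \<Otimes>\<^sub>M lborel). \<i> ^ k * complex_of_real ((cmod (A F p + \<i> ^ k * A G p))\<^sup>2))) / 4"
    by (simp only: integral_mult_right_zero integral_complex_of_real)
  also have "\<dots> = (LINT p|(lborel \<Otimes>\<^sub>M lborel). (\<Sum>k<4. \<i> ^ k * complex_of_real ((cmod (A F p + \<i> ^ k * A G p))\<^sup>2)) / 4)"
    using i by (subst Bochner_Integration.integral_sum[symmetric]) (auto simp del: of_real_power intro!: integrable_mult_right integrable_of_real)
  finally show "(\<Sum>k<4. \<i> ^ k * complex_of_real (enn2real (hardy_level \<kappa> l (\<lambda>p. F p + \<i> ^ k * G p) \<epsilon>))) / 4 =
      (LINT p|(lborel \<Otimes>\<^sub>M lborel). A F p * cnj (A G p))"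
    unfolding complex_polarization .
qed

section \<open>The reproducing property on the model domain\<close>

text \<open>The kernel of the model domain (\<open>l = 0\<close>) with pole at \<open>(0, w)\<close>; it does not depend on the first coordinate.\<close>

definition model_kernel :: "real \<Rightarrow> complex \<Rightarrow> complex \<times> complex \<Rightarrow> complex" where
  "model_kernel \<kappa> w p = - complex_of_real (\<kappa> / pi\<^sup>2) / (snd p - cnj w)\<^sup>2"

lemma holomorphic_on2_model_kernel:
  assumes k: "\<kappa> > 0" and w: "Im w > 0"
  shows "holomorphic_on2 (model_kernel \<kappa> w) (quad_domain \<kappa> 0)"
  unfolding holomorphic_on2_def
proof
  fix p assume "p \<in> quad_domain \<kappa> 0"
  then have "\<kappa> * (cmod (fst p))\<^sup>2 < Im (snd p)" by (auto simp: quad_domain_def quad_phase_def)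
  moreover have "0 \<le> \<kappa> * (cmod (fst p))\<^sup>2" using k by simp
  ultimately have ne: "snd p \<noteq> cnj w" using w by (auto simp: complex_eq_iff)
  let ?g = "\<lambda>z. - complex_of_real (\<kappa> / pi\<^sup>2) / (z - cnj w)\<^sup>2"
  have "?g holomorphic_on {z. z \<noteq> cnj w}" by (intro holomorphic_intros) auto
  moreover have "open {z. z \<noteq> cnj w}" by (rule open_Collect_neq) (intro continuous_intros)+
  ultimately have "(?g has_field_derivative deriv ?g (snd p)) (at (snd p))"
    using ne by (intro holomorphic_derivI) auto
  then have "(?g has_derivative (*) (deriv ?g (snd p))) (at (snd p))"
    by (simp add: has_field_derivative_def)
  from has_derivative_compose[OF has_derivative_snd[OF has_derivative_ident] this]
  have "(model_kernel \<kappa> w has_derivative (\<lambda>(h1, h2). 0 * h1 + deriv ?g (snd p) * h2)) (at p)"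
    by (simp add: model_kernel_def[abs_def] case_prod_beta')
  then show "\<exists>a b. (model_kernel \<kappa> w has_derivative (\<lambda>(h1, h2). a * h1 + b * h2)) (at p)"
    by blast
qed

text \<open>One of the two factors 1/Q is replaced by its maximum 1/B^2, the other is integrated
  exactly. The constant is not sharp; what matters is the power of \<open>B\<close>, which makes the
  bound integrable over the \<zeta>-plane.\<close>

lemma nn_integral_norm_inverse_square_le:
  assumes B: "B > 0"
  shows "(\<integral>\<^sup>+t. ennreal ((cmod (1 / (of_real t - Complex a B)\<^sup>2))\<^sup>2) \<partial>lborel) \<le> ennreal (pi / B ^ 3)"
proof -
  have "(\<integral>\<^sup>+t. ennreal ((cmod (1 / (of_real t - Complex a B)\<^sup>2))\<^sup>2) \<partial>lborel) \<le>
     (\<integral>\<^sup>+t. ennreal (1 / B\<^sup>2) * ennreal (1 / ((t - a)\<^sup>2 + B\<^sup>2)) \<partial>lborel)"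
  proof (rule nn_integral_mono)
    fix t
    define Q where "Q = (t - a)\<^sup>2 + B\<^sup>2"
    have Q: "Q \<ge> B\<^sup>2" "B\<^sup>2 > 0" using B by (auto simp: Q_def)
    have "(cmod (of_real t - Complex a B))\<^sup>2 = Q" by (simp add: cmod_power2 Q_def)
    moreover have "(cmod (1 / X\<^sup>2))\<^sup>2 = 1 / (cmod X)\<^sup>2 * (1 / (cmod X)\<^sup>2)" for X :: complex
      by (simp add: norm_divide norm_power power_divide flip: power_mult power_add)
    ultimately have "(cmod (1 / (of_real t - Complex a B)\<^sup>2))\<^sup>2 = 1 / Q * (1 / Q)"
      by (simp only:)
    also have "\<dots> \<le> 1 / B\<^sup>2 * (1 / Q)"
      using Q less_le_trans[OF Q(2,1)] by (intro mult_right_mono divide_left_mono mult_pos_pos) auto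
    finally show "ennreal ((cmod (1 / (of_real t - Complex a B)\<^sup>2))\<^sup>2) \<le> ennreal (1 / B\<^sup>2) * ennreal (1 / ((t - a)\<^sup>2 + B\<^sup>2))"
      using Q by (subst ennreal_mult[symmetric]) (auto simp: Q_def intro!: ennreal_leI)
  qed
  also have "\<dots> = ennreal (1 / B\<^sup>2) * ennreal (pi / B)"
    by (subst nn_integral_cmult) (auto simp: nn_integral_inverse_square_plus[OF B])
  also have "\<dots> = ennreal (pi / B ^ 3)"
    using B by (subst ennreal_mult[symmetric]) (auto simp: power2_eq_square power3_eq_cube)
  finally show ?thesis .
qed

lemma model_kernel_in_hardy_space:
  assumes k: "\<kappa> > 0" and w: "Im w > 0"
  shows "model_kernel \<kappa> w \<in> hardy_space \<kappa> 0"
proof -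
  define c where "c = - complex_of_real (\<kappa> / pi\<^sup>2)"
  define C where "C = ennreal ((cmod c)\<^sup>2) * (ennreal pi * ennreal (pi * (1 / (2 * \<kappa> * (Im w)\<^sup>2))))"
  have "hardy_level \<kappa> 0 (model_kernel \<kappa> w) \<epsilon> \<le> C" if e: "\<epsilon> > 0" for \<epsilon>
  proof -
    have pw: "(\<integral>\<^sup>+t. ennreal ((cmod (model_kernel \<kappa> w (\<zeta>, of_real t + \<i> * of_real (quad_phase \<kappa> 0 \<zeta> + \<epsilon>))))\<^sup>2) \<partial>lborel)
      \<le> ennreal ((cmod c)\<^sup>2) * ennreal (pi / (\<kappa> * (cmod \<zeta>)\<^sup>2 + Im w) ^ 3)" (is "?l \<le> _") for \<zeta>
    proof -
      \<comment> \<open>The vertical distance from the point on the level to the pole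
        \<open>cnj w\<close>. Dropping \<epsilon> from it at the end makes the estimate uniform over
        all levels.\<close>
      define B where "B = \<kappa> * (cmod \<zeta>)\<^sup>2 + \<epsilon> + Im w"
      have k0: "\<kappa> * (cmod \<zeta>)\<^sup>2 \<ge> 0" using k by simp
      then have B: "B \<ge> \<kappa> * (cmod \<zeta>)\<^sup>2 + Im w" "\<kappa> * (cmod \<zeta>)\<^sup>2 + Im w > 0" using e w by (auto simp: B_def)
      have "model_kernel \<kappa> w (\<zeta>, of_real t + \<i> * of_real (quad_phase \<kappa> 0 \<zeta> + \<epsilon>)) = c * (1 / (of_real t - Complex (Re w) (- B))\<^sup>2)" for t
      proof -
        have "of_real t + \<i> * of_real (quad_phase \<kappa> 0 \<zeta> + \<epsilon>) - cnj w = of_real t - Complex (Re w) (- B)"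
          by (simp add: complex_eq_iff B_def quad_phase_def)
        then show ?thesis unfolding model_kernel_def c_def snd_conv by (simp only: times_divide_eq_right mult_1_right)
      qed
      moreover have "cmod (1 / (of_real t - Complex (Re w) (- B))\<^sup>2) = cmod (1 / (of_real t - Complex (Re w) B)\<^sup>2)" for t
      proof -
        have "of_real t - Complex (Re w) (- B) = cnj (of_real t - Complex (Re w) B)"
          by (simp add: complex_eq_iff)
        then show ?thesis by (simp only: complex_mod_cnj norm_divide norm_power)
      qed
      ultimately have "cmod (model_kernel \<kappa> w (\<zeta>, of_real t + \<i> * of_real (quad_phase \<kappa> 0 \<zeta> + \<epsilon>))) = cmod c * cmod (1 / (of_real t - Complex (Re w) B)\<^sup>2)" for t
        by (simp only: norm_mult)
      then have "?l = (\<integral>\<^sup>+t. ennreal ((cmod c)\<^sup>2) * ennreal ((cmod (1 / (of_real t - Complex (Re w) B)\<^sup>2))\<^sup>2) \<partial>lborel)"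
        by (simp only: power_mult_distrib ennreal_mult' zero_le_power2)
      also have "\<dots> = ennreal ((cmod c)\<^sup>2) * (\<integral>\<^sup>+t. ennreal ((cmod (1 / (of_real t - Complex (Re w) B)\<^sup>2))\<^sup>2) \<partial>lborel)"
        by (rule nn_integral_cmult) measurable
      also have "\<dots> \<le> ennreal ((cmod c)\<^sup>2) * ennreal (pi / B ^ 3)"
        using B by (intro mult_left_mono nn_integral_norm_inverse_square_le) auto
      also have "\<dots> \<le> ennreal ((cmod c)\<^sup>2) * ennreal (pi / (\<kappa> * (cmod \<zeta>)\<^sup>2 + Im w) ^ 3)"
        using B by (intro mult_left_mono ennreal_leI divide_left_mono power_mono) auto
      finally show ?thesis .
    qed
    have "hardy_level \<kappa> 0 (model_kernel \<kappa> w) \<epsilon> \<le> (\<integral>\<^sup>+\<zeta>. ennreal ((cmod c)\<^sup>2) * ennreal (pi / (\<kappa> * (cmod (\<zeta>::complex))\<^sup>2 + Im w) ^ 3) \<partial>lborel)"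
      unfolding hardy_level_def by (rule nn_integral_mono) (rule pw)
    also have "\<dots> = ennreal ((cmod c)\<^sup>2) * (\<integral>\<^sup>+\<zeta>. ennreal (pi / (\<kappa> * (cmod (\<zeta>::complex))\<^sup>2 + Im w) ^ 3) \<partial>lborel)"
      by (rule nn_integral_cmult) measurable
    also have "(\<integral>\<^sup>+\<zeta>. ennreal (pi / (\<kappa> * (cmod (\<zeta>::complex))\<^sup>2 + Im w) ^ 3) \<partial>lborel)
       = ennreal pi * (\<integral>\<^sup>+u\<in>{0..}. ennreal (pi / (\<kappa> * u + Im w) ^ 3) \<partial>lborel)"
      by (rule nn_integral_radial_complex[where h="\<lambda>u. ennreal (pi / (\<kappa> * u + Im w) ^ 3)"]) measurable
    also have "(\<integral>\<^sup>+u\<in>{0..}. ennreal (pi / (\<kappa> * u + Im w) ^ 3) \<partial>lborel) = ennreal (0 - (- (pi / (2 * \<kappa> * (\<kappa> * 0 + Im w)\<^sup>2))))"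
    proof (rule nn_integral_FTC_atLeast)
      show "((\<lambda>u. - (pi / (2 * \<kappa> * (\<kappa> * u + Im w)\<^sup>2))) \<longlongrightarrow> 0) at_top"
        using k by real_asymp
      fix u :: real assume u: "0 \<le> u"
      have p: "\<kappa> * u + Im w > 0" using k w u by (simp add: add_nonneg_pos)
      then show "0 \<le> pi / (\<kappa> * u + Im w) ^ 3" by simp
      have "\<kappa> * u + Im w \<noteq> 0" using p by simp
      then show "DERIV (\<lambda>u. - (pi / (2 * \<kappa> * (\<kappa> * u + Im w)\<^sup>2))) u :> pi / (\<kappa> * u + Im w) ^ 3"
        using k by (auto intro!: derivative_eq_intros simp: divide_simps) (simp add: power2_eq_square power3_eq_cube power4_eq_xxxx)
    qed measurable
    finally show ?thesis by (simp add: C_def)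
  qed
  then have "hardy_norm_sq \<kappa> 0 (model_kernel \<kappa> w) \<le> C"
    unfolding hardy_norm_sq_eq_SUP_level by (intro SUP_least) auto
  also have "C < \<infinity>" by (simp add: C_def ennreal_mult_less_top)
  finally show ?thesis
    using holomorphic_on2_model_kernel[OF k w] by (simp add: hardy_space_def)
qed

lemma level_pairing_model_kernel:
  assumes k: "\<kappa> > 0" and w: "Im w > 0" and F: "F \<in> hardy_space \<kappa> 0" and e: "\<epsilon> > 0"
  shows "(LINT p|(lborel \<Otimes>\<^sub>M lborel). F (level_point \<kappa> 0 \<epsilon> p) * cnj (model_kernel \<kappa> w (level_point \<kappa> 0 \<epsilon> p)))
    = F (0, w + 2 * \<i> * of_real \<epsilon>)"
proof -
  have F': "holomorphic_on2 F (quad_domain \<kappa> 0)" using F by (simp add: hardy_space_def)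
  define c where "c = - complex_of_real (\<kappa> / pi\<^sup>2)"
  define f where "f z = F (0, z)" for z
  have hf: "f holomorphic_on {z. Im z > 0}"
    unfolding f_def by (rule holomorphic_on2_compose[OF F'])
      (auto simp: open_halfspace_Im_gt quad_domain_def quad_phase_def)
  have kr: "0 \<le> \<kappa> * (cmod u)\<^sup>2" for u using k by simp
  \<comment> \<open>The second coordinate of the level point depends on \<open>u\<close> through its
    modulus only, so rotating \<open>u\<close> leaves \<open>s\<close> and the kernel factor
    \<open>m\<close> unchanged.\<close>
  define s where "s u t = of_real t + \<i> * of_real (\<kappa> * (cmod u)\<^sup>2 + \<epsilon>)" for u :: complex and t :: real
  define m where "m u t = cnj (model_kernel \<kappa> w (0, s u t))" for u t
  define H where "H p = F (level_point \<kappa> 0 \<epsilon> p) * cnj (model_kernel \<kappa> w (level_point \<kappa> 0 \<epsilon> p))" for p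
  have Heq: "H (u, t) = F (u, s u t) * m u t" for u t
    by (simp add: H_def s_def m_def level_point_def model_kernel_def quad_phase_def)
  have intH: "integrable lborel H"
    using hardy_level_polarization(1)[OF F model_kernel_in_hardy_space[OF k w] e]
    by (simp add: H_def[abs_def] lborel_prod)
  define H0 where "H0 p = f (s (fst p) (snd p)) * m (fst p) (snd p)" for p
  have avg: "(LINT \<theta>:{0..1}|lborel. H (cis (2 * pi * \<theta>) * u, t)) = H0 (u, t)" for u t
  proof -
    let ?S = "{v. \<kappa> * (cmod v)\<^sup>2 < Im (s u t)}"
    have S: "open ?S" by (intro open_Collect_less continuous_intros)
    have S2: "cball 0 (cmod u) \<subseteq> ?S"
    proof
      fix v :: complex assume "v \<in> cball 0 (cmod u)"
      then have "\<kappa> * (cmod v)\<^sup>2 \<le> \<kappa> * (cmod u)\<^sup>2" using k by (intro mult_left_mono power_mono) auto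
      then show "v \<in> ?S" using e by (simp add: s_def)
    qed
    have "(\<lambda>v. F (v, s u t)) holomorphic_on ?S"
      by (rule holomorphic_on2_compose[OF F' S]) (auto simp: quad_domain_def quad_phase_def)
    from holomorphic_circle_mean(2)[OF this S S2, of u]
    have "(LINT \<theta>:{0..1}|lborel. F (cis (2 * pi * \<theta>) * u, s u t)) = f (s u t)" by (simp add: f_def)
    moreover have "H (cis (2 * pi * \<theta>) * u, t) = F (cis (2 * pi * \<theta>) * u, s u t) * m u t" for \<theta>
      by (simp add: Heq s_def m_def norm_mult)
    ultimately show ?thesis by (simp add: H0_def)
  qed
  note H0 = integral_rotation_average[OF intH avg]
  \<comment> \<open>The \<open>max\<close> only makes \<open>h\<close> continuous, hence measurable, on the whole line.\<close>
  define h where "h v = c * (2 * pi * \<i>) * deriv f (w + 2 * \<i> * of_real (\<kappa> * max v 0 + \<epsilon>))" for v :: real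
  have inner: "(LINT t|lborel. H0 (u, t)) = h ((cmod u)\<^sup>2)" for u
  proof -
    define y where "y = \<kappa> * (cmod u)\<^sup>2 + \<epsilon>"
    have y: "y \<ge> \<epsilon>" using kr by (simp add: y_def)
    \<comment> \<open>As a function of \<open>t\<close>, the conjugated kernel has its double pole
      at w + iy. Since \<open>f\<close> is read on the line of height \<open>y\<close>, Cauchy's
      formula produces f' at a + iy = w + 2iy.\<close>
    define a where "a = w + \<i> * of_real y"
    have a: "Im a > 0" using w y e by (simp add: a_def)
    let ?f = "\<lambda>z. f (z + \<i> * of_real y)"
    obtain M where M: "\<forall>z. Im z \<ge> \<kappa> * (cmod 0)\<^sup>2 + \<epsilon> / 2 \<longrightarrow> cmod (F (0, z)) \<le> M"
      using hardy_slice_bounded[OF k F, of "\<epsilon> / 2" 0] e by auto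
    have hol: "?f holomorphic_on {z. Im z > - (\<epsilon> / 2)}"
      by (rule holomorphic_on_compose_gen[OF _ hf, unfolded comp_def]) (use y e in \<open>auto intro!: holomorphic_intros\<close>)
    have bd: "\<forall>z. Im z > - (\<epsilon> / 2) \<longrightarrow> cmod (?f z) \<le> M"
      using M y by (auto simp: f_def)
    have "(LINT t|lborel. H0 (u, t)) = (LINT t|lborel. c * (?f (of_real t) / (of_real t - a)\<^sup>2))"
    proof (rule Bochner_Integration.integral_cong[OF refl])
      fix t
      have "m u t = c / (of_real t - a)\<^sup>2"
        by (simp add: m_def model_kernel_def c_def s_def y_def a_def algebra_simps)
      then show "H0 (u, t) = c * (?f (of_real t) / (of_real t - a)\<^sup>2)"
        by (simp add: H0_def s_def y_def)
    qed
    also have "\<dots> = c * (LINT t|lborel. ?f (of_real t) / (of_real t - a)\<^sup>2)"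
      by (rule integral_mult_right_zero)
    also have "\<dots> = c * (2 * pi * \<i> * deriv ?f a)"
      using cauchy_deriv_integral[OF hol _ bd a] e by simp
    also have "deriv ?f a = deriv f (a + \<i> * of_real y)"
    proof (rule DERIV_imp_deriv)
      have "(f has_field_derivative deriv f (a + \<i> * of_real y)) (at (a + \<i> * of_real y))"
        using a y e by (intro holomorphic_derivI[OF hf]) (auto simp: open_halfspace_Im_gt)
      then show "(?f has_field_derivative deriv f (a + \<i> * of_real y)) (at a)"
        by (simp add: DERIV_shift add.commute)
    qed
    finally show ?thesis by (simp add: h_def a_def y_def algebra_simps)
  qed
  have conth: "continuous_on UNIV h"
  proof -
    have "continuous_on {z. Im z > 0} (deriv f)"
      by (intro holomorphic_on_imp_continuous_on holomorphic_deriv hf open_halfspace_Im_gt)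
    then have "continuous_on UNIV (\<lambda>v. deriv f (w + 2 * \<i> * of_real (\<kappa> * max v 0 + \<epsilon>)))"
      by (rule continuous_on_compose2) (use w k e in \<open>auto intro!: continuous_intros add_pos_nonneg mult_nonneg_nonneg\<close>)
    then show ?thesis unfolding h_def by (intro continuous_intros)
  qed
  then have [measurable]: "h \<in> borel_measurable borel" by (rule borel_measurable_continuous_onI)
  have "integrable (lborel \<Otimes>\<^sub>M lborel) H0" using H0(1) by (simp add: lborel_prod)
  then have "integrable lborel (\<lambda>u. LINT t|lborel. H0 (u, t))" by (rule lborel_pair.integrable_fst')
  \<comment> \<open>Integrability of \<open>h\<close> is inherited from \<open>H0\<close> through
    Fubini's theorem and the radial formula; no growth estimate for f' is made.\<close>
  then have inth: "set_integrable lborel {0..} h"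
    unfolding inner by (subst (asm) integral_radial_complex(1)) auto
  have "(LINT p|lborel. H p) = (LINT p|(lborel \<Otimes>\<^sub>M lborel). H0 p)"
    using H0(2) by (simp add: lborel_prod)
  also have "\<dots> = (LINT u|lborel. LINT t|lborel. H0 (u, t))"
    by (rule lborel_pair.integral_fst'[symmetric]) fact
  also have "\<dots> = pi *\<^sub>R (LINT v:{0..}|lborel. h v)"
    unfolding inner by (rule integral_radial_complex(2)) measurable
  also have "(LINT v:{0..}|lborel. h v) = f (w + 2 * \<i> * of_real \<epsilon>) / pi"
  proof -
    \<comment> \<open>A primitive of \<open>h\<close> on the half line: the quotient by 2i\<kappa>
      compensates the inner derivative of w + 2i(\<kappa>v + \<epsilon>).\<close>
    define G where "G v = c * (2 * pi * \<i>) * (f (w + 2 * \<i> * of_real (\<kappa> * v + \<epsilon>)) / (2 * \<i> * of_real \<kappa>))" for v :: real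
    have dG: "(G has_vector_derivative h v) (at v within A)" if v: "v \<ge> 0" for v A
    proof -
      let ?L = "\<lambda>z. w + 2 * \<i> * (of_real \<kappa> * z + of_real \<epsilon>)"
      have p: "Im (?L (of_real v)) > 0" using w k e v by (simp add: add_pos_nonneg)
      have "((\<lambda>z. f (?L z)) has_field_derivative deriv f (?L (of_real v)) * (2 * \<i> * of_real \<kappa>)) (at (of_real v))"
        by (rule DERIV_chain2[of f _ ?L]) 
          (use p in \<open>auto intro!: derivative_eq_intros holomorphic_derivI[OF hf] simp: open_halfspace_Im_gt\<close>)
      then have "((\<lambda>z. c * (2 * pi * \<i>) * (f (?L z) / (2 * \<i> * of_real \<kappa>))) has_field_derivative c * (2 * pi * \<i>) * deriv f (?L (of_real v))) (at (of_real v))"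
        using k by (auto intro!: derivative_eq_intros)
      note d = has_vector_derivative_real_field[OF this]
      have "G = (\<lambda>v. c * (2 * pi * \<i>) * (f (?L (of_real v)) / (2 * \<i> * of_real \<kappa>)))"
        by (simp add: G_def fun_eq_iff)
      moreover have "h v = c * (2 * pi * \<i>) * deriv f (?L (of_real v))"
        using v by (simp add: h_def)
      ultimately show ?thesis using d by (simp only:)
    qed
    have seg: "(LINT v:{0..b}|lborel. h v) = G b - G 0" if "b \<ge> 0" for b
    proof -
      have "(h has_integral (G b - G 0)) {0..b}"
        using that dG by (intro fundamental_theorem_of_calculus) auto
      moreover have "set_integrable lborel {0..b} h"
        by (rule set_integrable_subset[OF inth]) auto
      ultimately show ?thesis by (simp add: set_borel_integral_eq_integral(2) integral_unique)
    qed
    have "((\<lambda>b. LINT v:{0..b}|lborel. h v) \<longlongrightarrow> (LINT v:{0..}|lborel. h v)) at_top"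
      by (rule tendsto_set_lebesgue_integral_at_top[OF _ inth]) auto
    moreover have "((\<lambda>b. LINT v:{0..b}|lborel. h v) \<longlongrightarrow> c * (2 * pi * \<i>) * (0 / (2 * \<i> * of_real \<kappa>)) - G 0) at_top"
    proof (rule Lim_transform_eventually)
      have "filterlim (\<lambda>b. 2 * (\<kappa> * b + \<epsilon>)) at_top at_top" using k by real_asymp
      from filterlim_compose[OF hardy_slice_tendsto_0[OF k F, of w] this]
      have "((\<lambda>b. f (w + 2 * \<i> * of_real (\<kappa> * b + \<epsilon>))) \<longlongrightarrow> 0) at_top"
        by (simp add: f_def algebra_simps)
      then show "((\<lambda>b. G b - G 0) \<longlongrightarrow> c * (2 * pi * \<i>) * (0 / (2 * \<i> * of_real \<kappa>)) - G 0) at_top"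
        unfolding G_def by (intro tendsto_intros) (use k in auto)
      show "\<forall>\<^sub>F b in at_top. G b - G 0 = (LINT v:{0..b}|lborel. h v)"
        using eventually_ge_at_top[of 0] by eventually_elim (simp add: seg)
    qed
    ultimately have "(LINT v:{0..}|lborel. h v) = c * (2 * pi * \<i>) * (0 / (2 * \<i> * of_real \<kappa>)) - G 0"
      by (rule tendsto_unique[rotated]) simp
    \<comment> \<open>Constants: -c * 2 pi i / (2i\<kappa>) = -c pi / \<kappa> = 1/pi, which cancels
      the pi from the area measure.\<close>
    then show ?thesis using k by (simp add: G_def c_def power2_eq_square)
  qed
  finally show ?thesis by (simp add: H_def[abs_def] lborel_prod f_def scaleR_conv_of_real)
qed

text \<open>The points where the level pairings evaluate \<open>F\<close> approach (0, w) inside the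
  domain, so continuity of \<open>F\<close> there identifies the limit.\<close>

lemma hardy_inner_model_kernel:
  assumes k: "\<kappa> > 0" and w: "Im w > 0" and F: "F \<in> hardy_space \<kappa> 0"
  shows "hardy_inner \<kappa> 0 F (model_kernel \<kappa> w) = F (0, w)"
proof -
  let ?e = "\<lambda>n. 1 / real (Suc n)" and ?K = "model_kernel \<kappa> w"
  have K: "?K \<in> hardy_space \<kappa> 0" by (rule model_kernel_in_hardy_space[OF k w])
  have "(\<lambda>n. (\<Sum>k<4. \<i> ^ k * complex_of_real (enn2real (hardy_level \<kappa> 0 (\<lambda>p. F p + \<i> ^ k * ?K p) (?e n)))) / 4)
     \<longlonglongrightarrow> hardy_inner \<kappa> 0 F ?K"
    unfolding hardy_inner_def
    by (intro tendsto_intros hardy_level_tendsto[OF k] hardy_space_add_cmult F K) auto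
  moreover have "(\<Sum>k<4. \<i> ^ k * complex_of_real (enn2real (hardy_level \<kappa> 0 (\<lambda>p. F p + \<i> ^ k * ?K p) (?e n)))) / 4
     = F (0, w + 2 * \<i> * of_real (?e n))" for n
    by (rule trans[OF hardy_level_polarization(2)[OF F K] level_pairing_model_kernel[OF k w F]]) simp_all
  moreover have "(\<lambda>n. F (0, w + 2 * \<i> * of_real (?e n))) \<longlonglongrightarrow> F (0, w)"
  proof -
    have "isCont F (0, w)"
      using F w continuous_on_eq_continuous_at[OF open_quad_domain, of \<kappa> 0 F]
      by (auto dest!: holomorphic_on2_continuous_on simp: hardy_space_def quad_domain_def quad_phase_def)
    moreover have "(\<lambda>n. (0, w + 2 * \<i> * of_real (?e n))) \<longlonglongrightarrow> (0, w + 2 * \<i> * of_real 0)"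
      by (intro tendsto_intros LIMSEQ_Suc lim_1_over_n)
    ultimately show ?thesis using isCont_tendsto_compose by fastforce
  qed
  ultimately show ?thesis by (simp add: LIMSEQ_unique)
qed

section \<open>Reduction to the model domain\<close>

text \<open>A Heisenberg translation composed with the shear that removes \<open>l\<close>: it maps the model domain onto
  the given one, its levels onto levels, and \<open>(0, w - heis_shift \<kappa> l w' 0)\<close> to \<open>(w', w)\<close>.\<close>

definition heis_shift :: "real \<Rightarrow> complex \<Rightarrow> complex \<Rightarrow> complex \<Rightarrow> complex" where
  "heis_shift \<kappa> l w' \<zeta> = \<i> * (of_real (\<kappa> * (cmod w')\<^sup>2) + 2 * of_real \<kappa> * cnj w' * \<zeta> - l * (w' + \<zeta>)\<^sup>2)"

definition heis_map :: "real \<Rightarrow> complex \<Rightarrow> complex \<Rightarrow> complex \<times> complex \<Rightarrow> complex \<times> complex" where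
  "heis_map \<kappa> l w' p = (w' + fst p, snd p + heis_shift \<kappa> l w' (fst p))"

text \<open>Expanding |w' + \<zeta>|^2 shows that \<open>quad_phase\<close> at w' + \<zeta> differs
  from \<kappa>|\<zeta>|^2 by the real part of a holomorphic polynomial in \<zeta>. The shift is i
  times that polynomial, which is why a holomorphic map can carry one domain to the other.\<close>

lemma Im_heis_shift: "\<kappa> * (cmod \<zeta>)\<^sup>2 + Im (heis_shift \<kappa> l w' \<zeta>) = quad_phase \<kappa> l (w' + \<zeta>)"
  unfolding heis_shift_def quad_phase_def cmod_power2
  by (simp add: power2_eq_square algebra_simps)

lemma heis_map_in_quad_domain: "heis_map \<kappa> l w' p \<in> quad_domain \<kappa> l \<longleftrightarrow> p \<in> quad_domain \<kappa> 0"
  using Im_heis_shift[of \<kappa> "fst p" l w'] by (auto simp: heis_map_def quad_domain_def quad_phase_def[of _ 0])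

lemma holomorphic_on2_heis_map:
  assumes F: "holomorphic_on2 F (quad_domain \<kappa> l)"
  shows "holomorphic_on2 (\<lambda>p. F (heis_map \<kappa> l w' p)) (quad_domain \<kappa> 0)"
  unfolding holomorphic_on2_def
proof
  fix p assume "p \<in> quad_domain \<kappa> 0"
  then have "heis_map \<kappa> l w' p \<in> quad_domain \<kappa> l" by (simp add: heis_map_in_quad_domain)
  then obtain a b where ab: "(F has_derivative (\<lambda>(h1, h2). a * h1 + b * h2)) (at (heis_map \<kappa> l w' p))"
    using F unfolding holomorphic_on2_def by blast
  define q where "q = \<i> * (2 * of_real \<kappa> * cnj w' - l * (2 * (w' + fst p)))"
  have "(heis_shift \<kappa> l w' has_field_derivative q) (at (fst p))"
    unfolding heis_shift_def q_def by (auto intro!: derivative_eq_intros)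
  then have "(heis_shift \<kappa> l w' has_derivative (*) q) (at (fst p))"
    by (simp add: has_field_derivative_def)
  from has_derivative_compose[OF has_derivative_fst[OF has_derivative_ident] this]
  have "((\<lambda>p. heis_shift \<kappa> l w' (fst p)) has_derivative (\<lambda>h. q * fst h)) (at p)" .
  then have "(heis_map \<kappa> l w' has_derivative (\<lambda>h. (0 + fst h, snd h + q * fst h))) (at p)"
    unfolding heis_map_def[abs_def]
    by (intro has_derivative_Pair has_derivative_add has_derivative_const has_derivative_fst has_derivative_snd has_derivative_ident)
  from has_derivative_compose[OF this ab]
  have "((\<lambda>p. F (heis_map \<kappa> l w' p)) has_derivative (\<lambda>h. case (0 + fst h, snd h + q * fst h) of (h1, h2) \<Rightarrow> a * h1 + b * h2)) (at p)" .
  moreover have "(\<lambda>h. case (0 + fst h, snd h + q * fst h) of (h1, h2) \<Rightarrow> a * h1 + b * h2) = (\<lambda>(h1, h2). (a + b * q) * h1 + b * h2)"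
    by (auto simp: algebra_simps)
  ultimately show "\<exists>a b. ((\<lambda>p. F (heis_map \<kappa> l w' p)) has_derivative (\<lambda>(h1, h2). a * h1 + b * h2)) (at p)"
    by metis
qed

text \<open>On each level the map acts on (\<zeta>, t) as a translation in \<zeta> followed by a
  translation in t whose amount depends on \<zeta>. Both preserve Lebesgue measure, and the height
  \<epsilon> is kept.\<close>

lemma hardy_norm_sq_heis_map:
  assumes F: "holomorphic_on2 F (quad_domain \<kappa> l)"
  shows "hardy_norm_sq \<kappa> 0 (\<lambda>p. F (heis_map \<kappa> l w' p)) = hardy_norm_sq \<kappa> l F"
  unfolding hardy_norm_sq_eq_SUP_level
proof (rule SUP_cong[OF refl])
  fix \<epsilon> :: real assume "\<epsilon> \<in> {0<..}"
  then have e: "\<epsilon> > 0" by simp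
  define T where "T u x = ennreal ((cmod (F (u, of_real x + \<i> * of_real (quad_phase \<kappa> l u + \<epsilon>))))\<^sup>2)" for u :: complex and x :: real
  have "(\<lambda>p. ennreal ((cmod (F (level_point \<kappa> l \<epsilon> p)))\<^sup>2)) \<in> borel_measurable (lborel \<Otimes>\<^sub>M lborel)"
    using measurable_level[OF F e] by measurable
  then have T: "(\<lambda>p. T (fst p) (snd p)) \<in> borel_measurable (lborel \<Otimes>\<^sub>M lborel)"
    by (simp add: T_def level_point_def)
  have Tu: "T u \<in> borel_measurable borel" for u
    using measurable_compose[OF measurable_Pair1' T, of u] by simp
  have TI: "(\<lambda>u. \<integral>\<^sup>+x. T u x \<partial>lborel) \<in> borel_measurable borel"
    using lborel.borel_measurable_nn_integral_fst[OF T] by simp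
  have "hardy_level \<kappa> 0 (\<lambda>p. F (heis_map \<kappa> l w' p)) \<epsilon> = (\<integral>\<^sup>+u. \<integral>\<^sup>+x. T (w' + u) (Re (heis_shift \<kappa> l w' u) + x) \<partial>lborel \<partial>lborel)"
    unfolding hardy_level_def
  proof (intro nn_integral_cong)
    fix u :: complex and x :: real
    have "of_real x + \<i> * of_real (quad_phase \<kappa> 0 u + \<epsilon>) + heis_shift \<kappa> l w' u
       = of_real (Re (heis_shift \<kappa> l w' u) + x) + \<i> * of_real (quad_phase \<kappa> l (w' + u) + \<epsilon>)"
      unfolding Im_heis_shift[symmetric] by (simp add: complex_eq_iff quad_phase_def)
    then show "ennreal ((cmod (F (heis_map \<kappa> l w' (u, of_real x + \<i> * of_real (quad_phase \<kappa> 0 u + \<epsilon>)))))\<^sup>2)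
      = T (w' + u) (Re (heis_shift \<kappa> l w' u) + x)"
      by (simp only: heis_map_def T_def fst_conv snd_conv)
  qed
  also have "\<dots> = (\<integral>\<^sup>+u. \<integral>\<^sup>+x. T (w' + u) x \<partial>lborel \<partial>lborel)"
    by (intro nn_integral_cong nn_integral_lborel_translate Tu)
  also have "\<dots> = (\<integral>\<^sup>+u. \<integral>\<^sup>+x. T u x \<partial>lborel \<partial>lborel)"
    by (rule nn_integral_lborel_translate[OF TI])
  finally show "hardy_level \<kappa> 0 (\<lambda>p. F (heis_map \<kappa> l w' p)) \<epsilon> = hardy_level \<kappa> l F \<epsilon>"
    by (simp add: hardy_level_def T_def)
qed

lemma hardy_space_heis_map:
  assumes "F \<in> hardy_space \<kappa> l"
  shows "(\<lambda>p. F (heis_map \<kappa> l w' p)) \<in> hardy_space \<kappa> 0"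
  using assms by (auto simp: hardy_space_def hardy_norm_sq_heis_map intro: holomorphic_on2_heis_map)

lemma hardy_inner_heis_map:
  assumes F: "F \<in> hardy_space \<kappa> l" and G: "G \<in> hardy_space \<kappa> l"
  shows "hardy_inner \<kappa> 0 (\<lambda>p. F (heis_map \<kappa> l w' p)) (\<lambda>p. G (heis_map \<kappa> l w' p)) = hardy_inner \<kappa> l F G"
proof -
  have "hardy_norm_sq \<kappa> 0 (\<lambda>p. F (heis_map \<kappa> l w' p) + \<i> ^ k * G (heis_map \<kappa> l w' p)) = hardy_norm_sq \<kappa> l (\<lambda>p. F p + \<i> ^ k * G p)" for k
    using hardy_space_add_cmult[OF F G, of "\<i> ^ k"]
    by (intro hardy_norm_sq_heis_map[of "\<lambda>p. F p + \<i> ^ k * G p"]) (simp add: hardy_space_def)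
  then show ?thesis by (simp add: hardy_inner_def)
qed

section \<open>The closed form and its transfer to the model domain\<close>

text \<open>Twice the defining function, polarized: holomorphic in \<open>p\<close>, antiholomorphic
  in \<open>q\<close>, and equal to 2(Im z - \<open>quad_phase\<close> \<kappa> l z') on the
  diagonal.\<close>

definition szego_base :: "real \<Rightarrow> complex \<Rightarrow> complex \<times> complex \<Rightarrow> complex \<times> complex \<Rightarrow> complex" where
  "szego_base \<kappa> l p q = \<i> * (cnj (snd q) - snd p) - 2 * complex_of_real \<kappa> * fst p * cnj (fst q)
     + (l * (fst p)\<^sup>2 + cnj l * (cnj (fst q))\<^sup>2)"

definition szego_formula :: "real \<Rightarrow> complex \<Rightarrow> complex \<times> complex \<Rightarrow> complex \<times> complex \<Rightarrow> complex" where
  "szego_formula \<kappa> l p q = complex_of_real (\<kappa> / pi\<^sup>2) * szego_base \<kappa> l p q powi (-2)"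

lemma szego_formula_eq: "szego_formula \<kappa> l p q = complex_of_real (\<kappa> / pi\<^sup>2) / (szego_base \<kappa> l p q)\<^sup>2"
  by (simp add: szego_formula_def power_int_minus field_simps)

lemma cnj_szego_formula: "cnj (szego_formula \<kappa> l q p) = szego_formula \<kappa> l p q"
proof -
  have "cnj (szego_base \<kappa> l q p) = szego_base \<kappa> l p q"
    by (simp add: szego_base_def algebra_simps)
  then show ?thesis by (simp add: szego_formula_eq)
qed

text \<open>The real part is the sum of the heights of both points above the surface plus
  \<kappa>|z' - w'|^2. In particular the closed form never divides by zero on the domain.\<close>

lemma Re_szego_base_pos:
  assumes k: "\<kappa> > 0" and p: "p \<in> quad_domain \<kappa> l" and q: "q \<in> quad_domain \<kappa> l"
  shows "Re (szego_base \<kappa> l p q) > 0"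
proof -
  have "0 \<le> \<kappa> * (cmod (fst p - fst q))\<^sup>2" using k by simp
  also have "\<dots> = quad_phase \<kappa> l (fst p) + quad_phase \<kappa> l (fst q) + (Re (szego_base \<kappa> l p q) - Im (snd p) - Im (snd q))"
    unfolding quad_phase_def cmod_power2 szego_base_def by (simp add: power2_eq_square algebra_simps)
  finally show ?thesis using p q by (auto simp: quad_domain_def)
qed

text \<open>The pulled back base is -i times the distance variable of the model kernel; squaring -i
  explains the minus sign in \<open>model_kernel\<close>.\<close>

lemma szego_formula_heis_map:
  "szego_formula \<kappa> l (heis_map \<kappa> l w' p) (w', w) = model_kernel \<kappa> (w - heis_shift \<kappa> l w' 0) p"
proof -
  have w2: "complex_of_real (cmod w') * complex_of_real (cmod w') = w' * cnj w'"
    using complex_norm_square[of w'] by (simp add: power2_eq_square)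
  have "szego_base \<kappa> l (heis_map \<kappa> l w' p) (w', w) = - \<i> * (snd p - cnj (w - heis_shift \<kappa> l w' 0))"
    by (simp add: szego_base_def heis_map_def heis_shift_def w2 algebra_simps power2_eq_square)
  then have "(szego_base \<kappa> l (heis_map \<kappa> l w' p) (w', w))\<^sup>2 = - (snd p - cnj (w - heis_shift \<kappa> l w' 0))\<^sup>2"
    by (simp only: power_mult_distrib) simp
  then show ?thesis by (simp only: szego_formula_eq model_kernel_def) simp
qed

text \<open>Holomorphy is verified directly, since \<open>holomorphic_on2_heis_map\<close> transfers
  only towards the model domain. Finiteness of the norm can then be read off there.\<close>

lemma szego_formula_in_hardy_space:
  assumes k: "\<kappa> > 0" and q: "(w', w) \<in> quad_domain \<kappa> l"
  shows "(\<lambda>p. szego_formula \<kappa> l p (w', w)) \<in> hardy_space \<kappa> l"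
proof -
  have h: "holomorphic_on2 (\<lambda>p. szego_formula \<kappa> l p (w', w)) (quad_domain \<kappa> l)"
    unfolding holomorphic_on2_def
  proof
    fix p assume "p \<in> quad_domain \<kappa> l"
    then have ne: "szego_base \<kappa> l p (w', w) \<noteq> 0" using Re_szego_base_pos[OF k _ q, of p] by auto
    define D1 where "D1 = - 2 * complex_of_real \<kappa> * cnj w' + 2 * l * fst p"
    have "((\<lambda>p. szego_base \<kappa> l p (w', w)) has_derivative (\<lambda>h. D1 * fst h - \<i> * snd h)) (at p)"
      unfolding szego_base_def D1_def
      by (auto intro!: derivative_eq_intros simp: fun_eq_iff algebra_simps)
    moreover have "((\<lambda>x. complex_of_real (\<kappa> / pi\<^sup>2) / x\<^sup>2) has_derivative (*) (deriv (\<lambda>x. complex_of_real (\<kappa> / pi\<^sup>2) / x\<^sup>2) (szego_base \<kappa> l p (w', w)))) (at (szego_base \<kappa> l p (w', w)))"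
    proof -
      have "(\<lambda>x. complex_of_real (\<kappa> / pi\<^sup>2) / x\<^sup>2) holomorphic_on {x. x \<noteq> 0}" by (intro holomorphic_intros) auto
      moreover have "open {x::complex. x \<noteq> 0}" by (rule open_Collect_neq) (intro continuous_intros)+
      ultimately have "((\<lambda>x. complex_of_real (\<kappa> / pi\<^sup>2) / x\<^sup>2) has_field_derivative deriv (\<lambda>x. complex_of_real (\<kappa> / pi\<^sup>2) / x\<^sup>2) (szego_base \<kappa> l p (w', w))) (at (szego_base \<kappa> l p (w', w)))"
        using ne by (intro holomorphic_derivI) auto
      then show ?thesis by (simp add: has_field_derivative_def)
    qed
    ultimately obtain d where "((\<lambda>p. szego_formula \<kappa> l p (w', w)) has_derivative (\<lambda>h. d * (D1 * fst h - \<i> * snd h))) (at p)"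
      unfolding szego_formula_eq using has_derivative_compose by blast
    moreover have "(\<lambda>h. d * (D1 * fst h - \<i> * snd h)) = (\<lambda>(h1, h2). (d * D1) * h1 + (- d * \<i>) * h2)"
      by (auto simp: algebra_simps)
    ultimately show "\<exists>a b. ((\<lambda>p. szego_formula \<kappa> l p (w', w)) has_derivative (\<lambda>(h1, h2). a * h1 + b * h2)) (at p)"
      by metis
  qed
  have w: "Im (w - heis_shift \<kappa> l w' 0) > 0"
    using q Im_heis_shift[of \<kappa> 0 l w'] by (auto simp: quad_domain_def)
  show ?thesis
    using h hardy_norm_sq_heis_map[OF h, of w'] model_kernel_in_hardy_space[OF k w]
    by (simp add: hardy_space_def szego_formula_heis_map)
qed

lemma is_szego_kernel_szego_formula:
  assumes k: "\<kappa> > 0"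
  shows "is_szego_kernel \<kappa> l (szego_formula \<kappa> l)"
  unfolding is_szego_kernel_def
proof (intro ballI conjI)
  fix q assume "q \<in> quad_domain \<kappa> l"
  moreover obtain w' w where q: "q = (w', w)" by force
  ultimately have qD: "(w', w) \<in> quad_domain \<kappa> l" by simp
  show S: "(\<lambda>p. szego_formula \<kappa> l p q) \<in> hardy_space \<kappa> l"
    unfolding q by (rule szego_formula_in_hardy_space[OF k qD])
  have w: "Im (w - heis_shift \<kappa> l w' 0) > 0"
    using qD Im_heis_shift[of \<kappa> 0 l w'] by (auto simp: quad_domain_def)
  fix F assume F: "F \<in> hardy_space \<kappa> l"
  have "hardy_inner \<kappa> l F (\<lambda>p. szego_formula \<kappa> l p q) = hardy_inner \<kappa> 0 (\<lambda>p. F (heis_map \<kappa> l w' p)) (model_kernel \<kappa> (w - heis_shift \<kappa> l w' 0))"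
    using hardy_inner_heis_map[OF F S, of w'] by (simp add: q szego_formula_heis_map)
  also have "\<dots> = F q"
    by (subst hardy_inner_model_kernel[OF k w hardy_space_heis_map[OF F]]) (simp add: heis_map_def q)
  finally show "F q = hardy_inner \<kappa> l F (\<lambda>p. szego_formula \<kappa> l p q)" ..
qed

section \<open>Hermitian symmetry and uniqueness\<close>

lemma hardy_norm_sq_cmult_unit:
  assumes "cmod c = 1"
  shows "hardy_norm_sq \<kappa> l (\<lambda>p. c * H p) = hardy_norm_sq \<kappa> l H"
  using assms by (simp add: hardy_norm_sq_def norm_mult)

text \<open>G + i^k F is a unit multiple of F + i^(-k) G. Exchanging the arguments therefore swaps
  the norms for k = 1 and k = 3, which is exactly what conjugating the coefficients does;
  sesquilinearity does not enter.\<close>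

lemma hardy_inner_cnj: "cnj (hardy_inner \<kappa> l F G) = hardy_inner \<kappa> l G F"
proof -
  have "hardy_norm_sq \<kappa> l (\<lambda>p. G p - F p) = hardy_norm_sq \<kappa> l (\<lambda>p. F p - G p)"
    using hardy_norm_sq_cmult_unit[of "-1" \<kappa> l "\<lambda>p. F p - G p"] by simp
  moreover have "hardy_norm_sq \<kappa> l (\<lambda>p. G p + \<i> * F p) = hardy_norm_sq \<kappa> l (\<lambda>p. F p - \<i> * G p)"
    using hardy_norm_sq_cmult_unit[of "\<i>" \<kappa> l "\<lambda>p. F p - \<i> * G p"] by (simp add: algebra_simps)
  moreover have "hardy_norm_sq \<kappa> l (\<lambda>p. G p - \<i> * F p) = hardy_norm_sq \<kappa> l (\<lambda>p. F p + \<i> * G p)"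
    using hardy_norm_sq_cmult_unit[of "-\<i>" \<kappa> l "\<lambda>p. F p + \<i> * G p"] by (simp add: algebra_simps)
  ultimately show ?thesis
    unfolding hardy_inner_def sum_lessThan_4 imaginary_unit_cubed by (simp add: algebra_simps)
qed

text \<open>Each kernel is fed to the other as a test function, so neither linearity nor
  definiteness of the inner product is invoked. Taking for \<open>K\<close> the Hermitian closed
  form turns this into equality with it.\<close>

lemma szego_kernel_unique:
  assumes S: "is_szego_kernel \<kappa> l S" and K: "is_szego_kernel \<kappa> l K"
    and p: "p \<in> quad_domain \<kappa> l" and q: "q \<in> quad_domain \<kappa> l"
  shows "S p q = cnj (K q p)"
proof -
  have member: "(\<lambda>z. T z v) \<in> hardy_space \<kappa> l"
    and reproduces: "\<forall>F\<in>hardy_space \<kappa> l. F v = hardy_inner \<kappa> l F (\<lambda>z. T z v)"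
    if "is_szego_kernel \<kappa> l T" "v \<in> quad_domain \<kappa> l" for T v
    using that by (simp_all add: is_szego_kernel_def)
  have "S p q = hardy_inner \<kappa> l (\<lambda>z. S z q) (\<lambda>z. K z p)"
    using bspec[OF reproduces[OF K p] member[OF S q]] .
  also have "\<dots> = cnj (hardy_inner \<kappa> l (\<lambda>z. K z p) (\<lambda>z. S z q))"
    by (rule hardy_inner_cnj[symmetric])
  also have "hardy_inner \<kappa> l (\<lambda>z. K z p) (\<lambda>z. S z q) = K q p"
    using bspec[OF reproduces[OF S q] member[OF K p]] ..
  finally show ?thesis .
qed

theorem mainTheorem4:
  fixes \<kappa> :: real and l :: complex
  assumes "\<kappa> > 0"
  shows "frontier (quad_domain \<kappa> l) = quad_surface \<kappa> l \<and>
    (\<exists>S. is_szego_kernel \<kappa> l S) \<and>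
    (\<forall>S. is_szego_kernel \<kappa> l S \<longrightarrow>
      (\<forall>z' z w' w. (z', z) \<in> quad_domain \<kappa> l \<longrightarrow> (w', w) \<in> quad_domain \<kappa> l \<longrightarrow>
        S (z', z) (w', w) =
          complex_of_real (\<kappa> / pi\<^sup>2) *
            (\<i> * (cnj w - z) - 2 * complex_of_real \<kappa> * z' * cnj w'
               + (l * z'\<^sup>2 + cnj l * (cnj w')\<^sup>2)) powi (-2)))"
proof (intro conjI allI impI)
  note K = is_szego_kernel_szego_formula[OF assms, of l]
  show "frontier (quad_domain \<kappa> l) = quad_surface \<kappa> l" by (rule frontier_quad_domain)
  show "\<exists>S. is_szego_kernel \<kappa> l S" using K by blast
  fix S z' z w' w
  assume "is_szego_kernel \<kappa> l S" "(z', z) \<in> quad_domain \<kappa> l" "(w', w) \<in> quad_domain \<kappa> l"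
  then have "S (z', z) (w', w) = szego_formula \<kappa> l (z', z) (w', w)"
    by (simp add: szego_kernel_unique[OF _ K] cnj_szego_formula)
  then show "S (z', z) (w', w) = complex_of_real (\<kappa> / pi\<^sup>2) *
            (\<i> * (cnj w - z) - 2 * complex_of_real \<kappa> * z' * cnj w'
               + (l * z'\<^sup>2 + cnj l * (cnj w')\<^sup>2)) powi (-2)"
    by (simp only: szego_formula_def szego_base_def fst_conv snd_conv)
qed

end
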